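(* Let $\phi\in L^2(\mathbb{Q}_p)$ be such that its Fourier transform $\widehat\phi$ is compactly supported, and for $j\in\mathbb{Z}$ let $V_j=\overline{\operatorname{span}\{\phi(p^{-j}x-a):\ a\in I_p\}}$ (closure in $L^2(\mathbb{Q}_p)$). Then $\bigcap_{j\in\mathbb{Z}}V_j=\{0\}$.
   Context: $p$ is a prime, $\mathbb{Q}_p$ the field of $p$-adic numbers with the $p$-adic norm $|\cdot|_p$. Every nonzero $x\in\mathbb{Q}_p$ has the canonical form $x=p^{\gamma}\sum_{j\ge0}x_jp^j$ with $\gamma\in\mathbb{Z}$, $x_j\in\{0,\dots,p-1\}$, $x_0\neq0$; its fractional part is $\{x\}_p=p^{\gamma}\sum_{j=0}^{-\gamma-1}x_jp^j$ (so $\{x\}_p=0$ iff $|x|_p\le1$), and $\{0\}_p=0$. $I_p=\{a\in\mathbb{Q}_p:\ \{a\}_p=a\}$. $B_\gamma(a)=\{x:|x-a|_p\le p^\gamma\}$. $dx$ is the Haar measure on $\mathbb{Q}_p$ normalized so that $B_0(0)$ has measure $1$, $\chi_p(x)=e^{2\pi i\{x\}_p}$, and the Fourier transform is $\widehat f(\xi)=\int_{\mathbb{Q}_p}\chi_p(\xi x)f(x)\,dx$, extended to $L^2(\mathbb{Q}_p)$ in the standard way. *)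

theory Defs
  imports "HOL-Analysis.Analysis"
begin

text \<open>p-adic numbers represented by their canonical digit expansions:
  x = sum over k of (x k) * p^k, digits in {0..p-1}, only finitely many nonzero
  digits at negative indices. This representation is a bijection onto Q_p.\<close>

definition qp :: "nat \<Rightarrow> (int \<Rightarrow> nat) set" where
  "qp p = {x. (\<forall>k. x k < p) \<and> (\<exists>N. \<forall>k<N. x k = 0)}"

definition pzero :: "int \<Rightarrow> nat" where
  "pzero = (\<lambda>_. 0)"

definition ppow :: "int \<Rightarrow> (int \<Rightarrow> nat)" where
  "ppow k = (\<lambda>i. if i = k then 1 else 0)"

definition ptrunc :: "nat \<Rightarrow> (int \<Rightarrow> nat) \<Rightarrow> int \<Rightarrow> real" where
  "ptrunc p x n = (\<Sum>k\<in>{k. k \<le> n \<and> x k \<noteq> 0}. real (x k) * real p powi k)"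

text \<open>the n-th p-adic digit of a number r in Z[1/p]\<close>
definition pdig :: "nat \<Rightarrow> real \<Rightarrow> int \<Rightarrow> nat" where
  "pdig p r n = nat (\<lfloor>r / real p powi n\<rfloor> mod int p)"

definition padd :: "nat \<Rightarrow> (int \<Rightarrow> nat) \<Rightarrow> (int \<Rightarrow> nat) \<Rightarrow> (int \<Rightarrow> nat)" where
  "padd p x y = (\<lambda>n. pdig p (ptrunc p x n + ptrunc p y n) n)"

definition psub :: "nat \<Rightarrow> (int \<Rightarrow> nat) \<Rightarrow> (int \<Rightarrow> nat) \<Rightarrow> (int \<Rightarrow> nat)" where
  "psub p x y = (\<lambda>n. pdig p (ptrunc p x n - ptrunc p y n) n)"

definition pmul :: "nat \<Rightarrow> (int \<Rightarrow> nat) \<Rightarrow> (int \<Rightarrow> nat) \<Rightarrow> (int \<Rightarrow> nat)" where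
  "pmul p x y = (\<lambda>n. THE d. \<forall>\<^sub>F m in sequentially.
      pdig p (ptrunc p x (int m) * ptrunc p y (int m)) n = d)"

definition pval :: "(int \<Rightarrow> nat) \<Rightarrow> int" where
  "pval x = (THE k. x k \<noteq> 0 \<and> (\<forall>i<k. x i = 0))"

definition pnorm :: "nat \<Rightarrow> (int \<Rightarrow> nat) \<Rightarrow> real" where
  "pnorm p x = (if x = pzero then 0 else real p powi (- pval x))"

definition pfrac :: "nat \<Rightarrow> (int \<Rightarrow> nat) \<Rightarrow> real" where
  "pfrac p x = (\<Sum>k\<in>{k. k < 0 \<and> x k \<noteq> 0}. real (x k) * real p powi k)"

definition pchar :: "nat \<Rightarrow> (int \<Rightarrow> nat) \<Rightarrow> complex" where
  "pchar p x = exp (2 * pi * \<i> * complex_of_real (pfrac p x))"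

text \<open>I_p = {a. {a}_p = a}: elements with no digits of nonnegative index\<close>
definition Ip :: "nat \<Rightarrow> (int \<Rightarrow> nat) set" where
  "Ip p = {a \<in> qp p. \<forall>k\<ge>0. a k = 0}"

definition pball :: "nat \<Rightarrow> int \<Rightarrow> (int \<Rightarrow> nat) \<Rightarrow> (int \<Rightarrow> nat) set" where
  "pball p \<gamma> a = {x \<in> qp p. pnorm p (psub p x a) \<le> real p powi \<gamma>}"

text \<open>Haar measure: the translation invariant measure on the Borel sets (generated by
  the balls, a countable base of the topology) with B_0(0) of measure 1.\<close>
definition haar :: "nat \<Rightarrow> (int \<Rightarrow> nat) measure" where
  "haar p = (THE M. space M = qp p
      \<and> sets M = sigma_sets (qp p) {pball p \<gamma> a | \<gamma> a. a \<in> qp p}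
      \<and> (\<forall>a\<in>qp p. \<forall>A\<in>sets M. emeasure M (padd p a ` A) = emeasure M A)
      \<and> emeasure M (pball p 0 pzero) = 1)"

definition pL2 :: "nat \<Rightarrow> ((int \<Rightarrow> nat) \<Rightarrow> complex) \<Rightarrow> bool" where
  "pL2 p f \<longleftrightarrow> f \<in> borel_measurable (haar p) \<and> integrable (haar p) (\<lambda>x. (cmod (f x))^2)"

definition pL1 :: "nat \<Rightarrow> ((int \<Rightarrow> nat) \<Rightarrow> complex) \<Rightarrow> bool" where
  "pL1 p f \<longleftrightarrow> integrable (haar p) f"

definition pdist2 :: "nat \<Rightarrow> ((int \<Rightarrow> nat) \<Rightarrow> complex) \<Rightarrow> ((int \<Rightarrow> nat) \<Rightarrow> complex) \<Rightarrow> ennreal" where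
  "pdist2 p f g = (\<integral>\<^sup>+ x. ennreal ((cmod (f x - g x))^2) \<partial>haar p)"

definition pfourier :: "nat \<Rightarrow> ((int \<Rightarrow> nat) \<Rightarrow> complex) \<Rightarrow> ((int \<Rightarrow> nat) \<Rightarrow> complex)" where
  "pfourier p f = (\<lambda>\<xi>. \<integral> x. pchar p (pmul p \<xi> x) * f x \<partial>haar p)"

text \<open>psi is the L^2 Fourier transform of phi: extension by continuity from L^1 \<inter> L^2\<close>
definition is_fourier_L2 :: "nat \<Rightarrow> ((int \<Rightarrow> nat) \<Rightarrow> complex) \<Rightarrow> ((int \<Rightarrow> nat) \<Rightarrow> complex) \<Rightarrow> bool" where
  "is_fourier_L2 p \<phi> \<psi> \<longleftrightarrow> pL2 p \<psi> \<and>
     (\<forall>fs. (\<forall>n. pL1 p (fs n) \<and> pL2 p (fs n)) \<and> (\<lambda>n. pdist2 p (fs n) \<phi>) \<longlonglongrightarrow> 0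
        \<longrightarrow> (\<lambda>n. pdist2 p (pfourier p (fs n)) \<psi>) \<longlonglongrightarrow> 0)"

definition pV :: "nat \<Rightarrow> ((int \<Rightarrow> nat) \<Rightarrow> complex) \<Rightarrow> int \<Rightarrow> ((int \<Rightarrow> nat) \<Rightarrow> complex) \<Rightarrow> bool" where
  "pV p \<phi> j f \<longleftrightarrow> (\<forall>\<epsilon>>0. \<exists>A c. finite A \<and> A \<subseteq> Ip p \<and>
      pdist2 p f (\<lambda>x. \<Sum>a\<in>A. c a * \<phi> (psub p (pmul p (ppow (- j)) x) a)) < ennreal \<epsilon>)"

end

(* The Fourier transform of phi is supported in the ball of radius p^gamma exactly when phi is
   invariant under translations by t with |t| <= p^(-gamma); only this consequence is needed, and
   it is used in the integrated form "the integral of phi over B_{-m}(a) depends only on a modulo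
   the ball B_{-gamma}(0)".  It follows from the duality
     p^m * (integral of phi over B_{-m}(a)) = (integral of conj(chi(xi a)) * psi(xi) over B_m(0)),
   which for cut-offs of phi is a finite character sum, so neither Plancherel nor Fubini is needed.
   Rescaling by p^(-j) turns the ball B_{-gamma} into B_{-gamma-j}, and the property passes to
   L2 limits.  Letting j tend to minus infinity, an element of all V_j has the same integral over
   all balls of a given radius; the L2 bound on large balls forces these integrals to vanish. *)
theory Submission
  imports Defs
begin

subsection \<open>Digit arithmetic\<close>

text \<open>Numbers are bare digit functions whose operations read digits off real truncations, so
  all arithmetic is reduced to congruences modulo p^n Z between reals. Multiplication enters only
  through powers of p, where it is a digit shift, and inside the character, where finitely many
  digits of each factor decide the value. \<open>haar\<close> is a definite description: a measure
  with the required properties has to be constructed and shown to be unique before anything can be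
  integrated. Ball integrals are the observables throughout for three reasons. They are continuous
  in L2 by Cauchy-Schwarz, so they pass to closures and to the limit that defines the transform.
  Affine substitutions carry balls to balls. Finally, the balls and the empty set form an
  intersection-stable generator of the Borel sets, so a function whose ball integrals all vanish is
  zero almost everywhere.\<close>

definition pcong :: "nat \<Rightarrow> int \<Rightarrow> real \<Rightarrow> real \<Rightarrow> bool" where
  "pcong p n r s \<longleftrightarrow> (\<exists>z::int. r - s = of_int z * real p powi n)"

lemma pcong_refl [simp]: "pcong p n r r"
  by (auto simp: pcong_def intro: exI[of _ 0])

lemma pcong_sym: "pcong p n r s \<Longrightarrow> pcong p n s r"
  unfolding pcong_def by (metis minus_diff_eq mult_minus_left of_int_minus)

lemma pcong_trans [trans]: "pcong p n r s \<Longrightarrow> pcong p n s t \<Longrightarrow> pcong p n r t"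
proof -
  assume "pcong p n r s" "pcong p n s t"
  then obtain y z :: int where "r - s = of_int y * real p powi n" "s - t = of_int z * real p powi n"
    by (auto simp: pcong_def)
  then have "r - t = of_int (y + z) * real p powi n" by (simp add: algebra_simps)
  then show ?thesis unfolding pcong_def by blast
qed

lemma pcong_add: "pcong p n r s \<Longrightarrow> pcong p n r' s' \<Longrightarrow> pcong p n (r + r') (s + s')"
proof -
  assume "pcong p n r s" "pcong p n r' s'"
  then obtain y z :: int where "r - s = of_int y * real p powi n" "r' - s' = of_int z * real p powi n"
    by (auto simp: pcong_def)
  then have "(r + r') - (s + s') = of_int (y + z) * real p powi n" by (simp add: algebra_simps)
  then show ?thesis unfolding pcong_def by blast
qed

lemma pcong_minus: "pcong p n r s \<Longrightarrow> pcong p n (- r) (- s)"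
  unfolding pcong_def by (metis minus_diff_minus mult_minus_left of_int_minus)

lemma pcong_diff: "pcong p n r s \<Longrightarrow> pcong p n r' s' \<Longrightarrow> pcong p n (r - r') (s - s')"
  using pcong_add[of p n r s "- r'" "- s'"] pcong_minus[of p n r' s'] by simp

text \<open>The terms are the powers of a K-th root of unity. It differs from 1 because K does not
  divide l, so the geometric sum vanishes.\<close>

lemma sum_cis_eq_0:
  fixes l :: int
  assumes "0 < K" "\<not> int K dvd l"
  shows "(\<Sum>k<K. cis (2 * pi * (real k * (of_int l / real K)))) = 0"
proof -
  define w where "w = cis (2 * pi * (of_int l / real K))"
  have "w ^ K = cis (2 * pi * of_int l)"
    unfolding w_def Complex.DeMoivre using assms by (intro arg_cong[of _ _ cis]) simp
  then have wK: "w ^ K = 1" by simp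
  have "w \<noteq> 1"
  proof
    assume "w = 1"
    then have "exp (\<i> * complex_of_real (2 * pi * (of_int l / real K))) = 1"
      by (simp add: w_def cis_conv_exp)
    then obtain n :: int where "2 * pi * (of_int l / real K) = of_int (2 * n) * pi"
      unfolding exp_eq_1 by auto
    then have "of_int l = real_of_int (n * int K)" using assms by (simp add: field_simps)
    then have "l = n * int K" by linarith
    then show False using assms by simp
  qed
  moreover have "(1 - w) * (\<Sum>k<K. w ^ k) = 0" using one_diff_power_eq[of w K] wK by simp
  ultimately have "(\<Sum>k<K. w ^ k) = 0" by simp
  then show ?thesis by (simp add: w_def Complex.DeMoivre mult_ac)
qed

text \<open>Cauchy-Schwarz against the indicator of B. The right-hand side is an extended real, so
  it can be compared directly with \<open>pdist2\<close>, and every passage to an L2 limit below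
  goes through this bound.\<close>

lemma sq_norm_set_integral_diff_le:
  fixes u v :: "'a \<Rightarrow> 'b::{banach, second_countable_topology}"
  assumes B [measurable]: "B \<in> sets M" and u: "set_integrable M B u" and v: "set_integrable M B v"
  shows "ennreal ((norm ((LINT x:B|M. u x) - (LINT x:B|M. v x)))\<^sup>2)
    \<le> emeasure M B * (\<integral>\<^sup>+x. ennreal ((norm (u x - v x))\<^sup>2) \<partial>M)"
proof -
  define d where "d x = indicator B x *\<^sub>R (u x - v x)" for x
  have d: "integrable M d" using set_integral_diff(1)[OF u v] by (simp add: d_def[abs_def] set_integrable_def)
  then have [measurable]: "d \<in> borel_measurable M" by simp
  have "(LINT x:B|M. u x) - (LINT x:B|M. v x) = integral\<^sup>L M d"
    using set_integral_diff(2)[OF u v] by (simp add: d_def[abs_def] set_lebesgue_integral_def)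
  then have "ennreal (norm ((LINT x:B|M. u x) - (LINT x:B|M. v x))) \<le> (\<integral>\<^sup>+x. norm (d x) \<partial>M)"
    using integral_norm_bound_ennreal[OF d] by simp
  also have "\<dots> = (\<integral>\<^sup>+x. indicator B x * ennreal (norm (d x)) \<partial>M)"
    by (rule nn_integral_cong) (simp add: d_def indicator_def)
  finally have "(ennreal (norm ((LINT x:B|M. u x) - (LINT x:B|M. v x))))\<^sup>2
      \<le> (\<integral>\<^sup>+x. indicator B x * ennreal (norm (d x)) \<partial>M)\<^sup>2"
    by (rule power_mono) simp
  also have "\<dots> \<le> (\<integral>\<^sup>+x. (indicator B x)\<^sup>2 \<partial>M) * (\<integral>\<^sup>+x. (ennreal (norm (d x)))\<^sup>2 \<partial>M)"
    by (rule Cauchy_Schwarz_nn_integral) simp_all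
  also have "(\<integral>\<^sup>+x. (indicator B x)\<^sup>2 \<partial>M) = (\<integral>\<^sup>+x. indicator B x \<partial>M)"
    by (rule nn_integral_cong) (simp add: indicator_def)
  also have "\<dots> = emeasure M B" by simp
  also have "(\<integral>\<^sup>+x. (ennreal (norm (d x)))\<^sup>2 \<partial>M) \<le> (\<integral>\<^sup>+x. ennreal ((norm (u x - v x))\<^sup>2) \<partial>M)"
    by (rule nn_integral_mono) (simp add: d_def indicator_def ennreal_power)
  finally show ?thesis by (simp add: ennreal_power mult_left_mono)
qed

section \<open>Congruences, digits and truncations to base p\<close>

locale padic_base =
  fixes p :: nat
  assumes p_gt_1: "1 < p"
begin

lemma p_nonzero [simp]: "p \<noteq> 0"
  using p_gt_1 by simp

lemma powi_pos [simp]: "0 < real p powi n"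
  using p_gt_1 by simp

lemma powi_nz [simp]: "real p powi n \<noteq> 0"
  using p_gt_1 by simp

lemma powi_add: "real p powi (m + n) = real p powi m * real p powi n"
  using p_gt_1 by (simp add: power_int_add)

lemma powi_succ: "real p powi (n + 1) = real p * real p powi n"
  using p_gt_1 by (simp add: power_int_add)

lemma powi_of_le: "m \<le> n \<Longrightarrow> \<exists>k::nat. real p powi n = real k * real p powi m"
proof -
  assume "m \<le> n"
  have "real p powi n = real p powi (n - m) * real p powi m" by (simp flip: powi_add)
  also have "\<dots> = real (p ^ nat (n - m)) * real p powi m"
    using \<open>m \<le> n\<close> by (simp add: power_int_def)
  finally show ?thesis by blast
qed

lemma pcong_le: "m \<le> n \<Longrightarrow> pcong p n r s \<Longrightarrow> pcong p m r s"
proof -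
  assume "m \<le> n" "pcong p n r s"
  then obtain z :: int and k :: nat where "r - s = of_int z * real p powi n"
    "real p powi n = real k * real p powi m"
    using powi_of_le unfolding pcong_def by metis
  then have "r - s = of_int (z * int k) * real p powi m" by simp
  then show ?thesis unfolding pcong_def by blast
qed

text \<open>Multiplying by a multiple of p^k shifts the precision by k, and k may be negative. This
  is the bookkeeping for products of truncations.\<close>

lemma pcong_mult: "pcong p n r s \<Longrightarrow> pcong p k t 0 \<Longrightarrow> pcong p (n + k) (r * t) (s * t)"
proof -
  assume "pcong p n r s" "pcong p k t 0"
  then obtain y z :: int where "r - s = of_int y * real p powi n" "t = of_int z * real p powi k"
    by (auto simp: pcong_def)
  then have "r * t - s * t = of_int (y * z) * real p powi (n + k)"
    by (simp add: powi_add flip: left_diff_distrib)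
  then show ?thesis unfolding pcong_def by blast
qed

lemma pcong_mult': "pcong p n r s \<Longrightarrow> pcong p k t 0 \<Longrightarrow> pcong p (n + k) (t * r) (t * s)"
  using pcong_mult[of n r s k t] by (simp add: mult.commute)

lemma pcong_eq:
  assumes "pcong p n r s" "0 \<le> r" "r < real p powi n" "0 \<le> s" "s < real p powi n"
  shows "r = s"
proof -
  obtain z :: int where z: "r - s = of_int z * real p powi n"
    using assms by (auto simp: pcong_def)
  have "\<bar>r - s\<bar> < 1 * real p powi n" using assms by auto
  then have "\<bar>of_int z :: real\<bar> * real p powi n < 1 * real p powi n" by (simp add: z abs_mult)
  then have "\<bar>of_int z :: real\<bar> < 1" using powi_pos by (metis mult_less_cancel_right_pos)
  then have "z = 0" by linarith
  then show ?thesis using z by simp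
qed

text \<open>Changing r by a multiple of p^(n+1) moves the floor of r / p^n by a multiple of
  p.\<close>

lemma pdig_cong: "pcong p (n + 1) r s \<Longrightarrow> pdig p r n = pdig p s n"
proof -
  assume "pcong p (n + 1) r s"
  then obtain z :: int where "r - s = of_int z * real p powi (n + 1)" unfolding pcong_def by blast
  then have "r - s = of_int z * (real p * real p powi n)" by (simp only: powi_succ)
  then have "r / real p powi n = s / real p powi n + of_int (z * int p)"
    by (simp add: field_simps)
  then have "\<lfloor>r / real p powi n\<rfloor> = \<lfloor>s / real p powi n\<rfloor> + z * int p"
    by (metis floor_add_int)
  then show ?thesis by (simp add: pdig_def)
qed

lemma pdig_less: "pdig p r n < p"
  using p_gt_1 by (simp add: pdig_def nat_less_iff)

lemma pdig_scale: "pdig p (real p powi k * r) n = pdig p r (n - k)"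
proof -
  have "real p powi n = real p powi k * real p powi (n - k)"
    by (simp flip: powi_add)
  then have "real p powi k * r / real p powi n = r / real p powi (n - k)" by (simp add: field_simps)
  then show ?thesis by (simp add: pdig_def)
qed

lemma ptrunc_zero: "(\<And>k. k \<le> n \<Longrightarrow> x k = 0) \<Longrightarrow> ptrunc p x n = 0"
  unfolding ptrunc_def by (rule sum.neutral) auto

lemma finite_digits:
  assumes "x \<in> qp p" shows "finite {k. k \<le> n \<and> x k \<noteq> 0}"
proof -
  obtain N where "\<forall>k<N. x k = 0" using assms by (auto simp: qp_def)
  then have "{k. k \<le> n \<and> x k \<noteq> 0} \<subseteq> {N..n}"
    by (metis (mono_tags, lifting) atLeastAtMost_iff linorder_not_le mem_Collect_eq subsetI)
  then show ?thesis by (rule finite_subset) simp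
qed

lemma ptrunc_succ:
  assumes "x \<in> qp p"
  shows "ptrunc p x (n + 1) = ptrunc p x n + real (x (n + 1)) * real p powi (n + 1)"
proof (cases "x (n + 1) = 0")
  case True
  then have "{k. k \<le> n + 1 \<and> x k \<noteq> 0} = {k. k \<le> n \<and> x k \<noteq> 0}"
    by (auto simp: order.order_iff_strict zle_add1_eq_le[symmetric])
  then show ?thesis using True by (simp add: ptrunc_def)
next
  case False
  then have "{k. k \<le> n + 1 \<and> x k \<noteq> 0} = insert (n + 1) {k. k \<le> n \<and> x k \<noteq> 0}"
    by auto
  then show ?thesis using finite_digits[OF assms, of n] by (simp add: ptrunc_def add.commute)
qed

lemma qp_digit_less: "x \<in> qp p \<Longrightarrow> x k < p"
  by (simp add: qp_def)

lemma qpE: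
  assumes "x \<in> qp p" obtains N where "\<And>k. k < N \<Longrightarrow> x k = 0"
  using assms by (auto simp: qp_def)

text \<open>Expansions have no common first index, so the base case is a whole ray: in applications,
  the indices below some N where all digits vanish.\<close>

lemma int_induct_from_below:
  assumes "\<And>n. n < N \<Longrightarrow> P n" and "\<And>n. P n \<Longrightarrow> P (n + 1)"
  shows "P (n::int)"
proof (cases "n < N")
  case False
  then have "N - 1 \<le> n" by simp
  then show ?thesis
    by (induction n rule: int_ge_induct) (use assms in auto)
qed (use assms in auto)

lemma ptrunc_bounds:
  assumes "x \<in> qp p"
  shows "0 \<le> ptrunc p x n \<and> ptrunc p x n < real p powi (n + 1)"
proof -
  obtain N where N: "\<And>k. k < N \<Longrightarrow> x k = 0" using assms qpE by blast
  show ?thesis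
  proof (induction n rule: int_induct_from_below[where N = N])
    case (1 n)
    then have "ptrunc p x n = 0" using N by (intro ptrunc_zero) auto
    then show ?case by simp
  next
    case (2 n)
    have "real (x (n + 1)) + 1 \<le> real p" using qp_digit_less[OF assms, of "n + 1"] by linarith
    then have "(real (x (n + 1)) + 1) * real p powi (n + 1) \<le> real p * real p powi (n + 1)"
      by (intro mult_right_mono) auto
    then have "ptrunc p x (n + 1) < real p powi (n + 1 + 1)"
      using 2 unfolding ptrunc_succ[OF assms] powi_succ[of "n + 1"] by (simp add: algebra_simps)
    then show ?case using 2 ptrunc_succ[OF assms, of n] by (simp add: less_imp_le)
  qed
qed



lemma ptrunc_integral:
  assumes "x \<in> qp p" and N: "\<And>k. k < N \<Longrightarrow> x k = 0"
  shows "pcong p N (ptrunc p x n) 0"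
proof (induction n rule: int_induct_from_below[where N = N])
  case (1 n)
  then have "ptrunc p x n = 0" using N by (intro ptrunc_zero) auto
  then show ?case by simp
next
  case (2 n)
  have "pcong p N (real (x (n + 1)) * real p powi (n + 1)) 0"
  proof (cases "n + 1 < N")
    case True then show ?thesis using N by simp
  next
    case False
    have "pcong p (n + 1) (real (x (n + 1)) * real p powi (n + 1)) 0"
      unfolding pcong_def by (intro exI[of _ "int (x (n + 1))"]) simp
    then show ?thesis using False by (intro pcong_le[of N "n + 1"]) auto
  qed
  then show ?case using pcong_add[OF 2] ptrunc_succ[OF assms(1), of n] by fastforce
qed

lemma ptrunc_cong_succ: "x \<in> qp p \<Longrightarrow> pcong p (n + 1) (ptrunc p x (n + 1)) (ptrunc p x n)"
  unfolding pcong_def by (intro exI[of _ "int (x (n + 1))"]) (simp add: ptrunc_succ)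

lemma ptrunc_cong: "x \<in> qp p \<Longrightarrow> n \<le> m \<Longrightarrow> pcong p (n + 1) (ptrunc p x m) (ptrunc p x n)"
proof -
  assume x: "x \<in> qp p" and "n \<le> m"
  from \<open>n \<le> m\<close> show ?thesis
  proof (induction m rule: int_ge_induct)
    case (step i)
    have "pcong p (n + 1) (ptrunc p x (i + 1)) (ptrunc p x i)"
      using step ptrunc_cong_succ[OF x] by (intro pcong_le[of "n + 1" "i + 1"]) auto
    then show ?case using step pcong_trans by blast
  qed simp
qed

lemma pdig_top:
  assumes "0 \<le> t" "t < real p powi n" "d < p"
  shows "pdig p (t + real d * real p powi n) n = d"
proof -
  have "\<lfloor>(t + real d * real p powi n) / real p powi n\<rfloor> = int d"
    using assms by (intro floor_unique) (auto simp: field_simps)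
  then show ?thesis using assms by (simp add: pdig_def)
qed

lemma pdig_ptrunc:
  assumes "x \<in> qp p" "n \<le> m" shows "pdig p (ptrunc p x m) n = x n"
proof -
  have "pdig p (ptrunc p x m) n = pdig p (ptrunc p x n) n"
    by (intro pdig_cong ptrunc_cong assms)
  also have "ptrunc p x n = ptrunc p x (n - 1) + real (x n) * real p powi n"
    using ptrunc_succ[OF assms(1), of "n - 1"] by simp
  also have "pdig p \<dots> n = x n"
    using ptrunc_bounds[OF assms(1), of "n - 1"] by (intro pdig_top qp_digit_less assms) auto
  finally show ?thesis .
qed

text \<open>A p-adic number as an inverse limit: r n stands for a residue modulo p^(n+1), and it may
  be negative or too large to be a truncation itself. The common bound N keeps the expansion finite
  to the left. Sums, differences and products are all instances.\<close>

lemma coherent_digits: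
  assumes coh: "\<And>n. pcong p (n + 1) (r (n + 1)) (r n)" and N: "\<And>n. pcong p N (r n) 0"
  defines "y \<equiv> (\<lambda>n. pdig p (r n) n)"
  shows "y \<in> qp p" "pcong p (n + 1) (ptrunc p y n) (r n)"
proof -
  have y0: "y n = 0" if "n < N" for n
  proof -
    have "y n = pdig p 0 n" unfolding y_def
      using that by (intro pdig_cong pcong_le[of "n + 1" N] N) auto
    then show ?thesis by (simp add: pdig_def)
  qed
  then show y: "y \<in> qp p" by (auto simp: qp_def y_def pdig_less)
  show "pcong p (n + 1) (ptrunc p y n) (r n)"
  proof (induction n rule: int_induct_from_below[where N = N])
    case (1 n)
    have "ptrunc p y n = 0" using 1 y0 by (intro ptrunc_zero) auto
    moreover have "pcong p (n + 1) (r n) 0" using 1 by (intro pcong_le[of "n + 1" N] N) auto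
    ultimately show ?case by (simp add: pcong_sym)
  next
    case (2 n)
    have "pcong p (n + 1) (r (n + 1)) (ptrunc p y n)"
      using coh[of n] pcong_sym[OF 2] pcong_trans by blast
    then obtain z :: int where z: "r (n + 1) = ptrunc p y n + of_int z * real p powi (n + 1)"
      by (auto simp: pcong_def algebra_simps)
    \<comment> \<open>The truncation of y at n lies in [0, p^(n+1)), so it disappears in the floor.
      The new digit is z mod p, and z div p contributes only a multiple of p^(n+2).\<close>
    have "\<lfloor>r (n + 1) / real p powi (n + 1)\<rfloor> = z"
      using ptrunc_bounds[OF y, of n] by (intro floor_unique) (simp_all add: z add_divide_distrib)
    then have yd: "int (y (n + 1)) = z mod int p"
      using p_gt_1 by (simp add: y_def pdig_def)
    then have "z = int (y (n + 1)) + (z div int p) * int p" by simp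
    then have "real_of_int z = real (y (n + 1)) + of_int (z div int p) * real p"
      by (metis of_int_add of_int_mult of_int_of_nat_eq)
    then obtain q :: int where q: "real_of_int z = real (y (n + 1)) + of_int q * real p" by blast
    have "ptrunc p y (n + 1) - r (n + 1) = of_int (- q) * real p powi (n + 1 + 1)"
      unfolding ptrunc_succ[OF y] z powi_succ[of "n + 1"] q by (simp only: of_int_minus) algebra
    then show ?case unfolding pcong_def by blast
  qed
qed

section \<open>Sum, difference and product of digit expansions\<close>

lemma qp_common_bound:
  assumes "x \<in> qp p" "y \<in> qp p"
  obtains N where "\<And>k. k < N \<Longrightarrow> x k = 0" "\<And>k. k < N \<Longrightarrow> y k = 0"
proof -
  obtain M N where "\<And>k. k < M \<Longrightarrow> x k = 0" "\<And>k. k < N \<Longrightarrow> y k = 0"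
    using assms qpE by metis
  then show ?thesis by (intro that[of "min M N"]) auto
qed

lemma padd_qp: "x \<in> qp p \<Longrightarrow> y \<in> qp p \<Longrightarrow> padd p x y \<in> qp p"
  and ptrunc_padd: "x \<in> qp p \<Longrightarrow> y \<in> qp p \<Longrightarrow>
    pcong p (n + 1) (ptrunc p (padd p x y) n) (ptrunc p x n + ptrunc p y n)"
proof -
  assume x: "x \<in> qp p" and y: "y \<in> qp p"
  obtain N where N: "\<And>k. k < N \<Longrightarrow> x k = 0" "\<And>k. k < N \<Longrightarrow> y k = 0"
    using qp_common_bound x y by metis
  have 1: "pcong p (n + 1) (ptrunc p x (n + 1) + ptrunc p y (n + 1)) (ptrunc p x n + ptrunc p y n)"
    for n by (intro pcong_add ptrunc_cong_succ x y)
  have 2: "pcong p N (ptrunc p x n + ptrunc p y n) 0" for n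
    using pcong_add[OF ptrunc_integral[OF x N(1)] ptrunc_integral[OF y N(2)]] by simp
  note coherent_digits[of "\<lambda>n. ptrunc p x n + ptrunc p y n", OF 1 2]
  then show "padd p x y \<in> qp p"
    "pcong p (n + 1) (ptrunc p (padd p x y) n) (ptrunc p x n + ptrunc p y n)"
    by (simp_all add: padd_def)
qed

lemma psub_qp: "x \<in> qp p \<Longrightarrow> y \<in> qp p \<Longrightarrow> psub p x y \<in> qp p"
  and ptrunc_psub: "x \<in> qp p \<Longrightarrow> y \<in> qp p \<Longrightarrow>
    pcong p (n + 1) (ptrunc p (psub p x y) n) (ptrunc p x n - ptrunc p y n)"
proof -
  assume x: "x \<in> qp p" and y: "y \<in> qp p"
  obtain N where N: "\<And>k. k < N \<Longrightarrow> x k = 0" "\<And>k. k < N \<Longrightarrow> y k = 0"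
    using qp_common_bound x y by metis
  have 1: "pcong p (n + 1) (ptrunc p x (n + 1) - ptrunc p y (n + 1)) (ptrunc p x n - ptrunc p y n)"
    for n by (intro pcong_diff ptrunc_cong_succ x y)
  have 2: "pcong p N (ptrunc p x n - ptrunc p y n) 0" for n
    using pcong_diff[OF ptrunc_integral[OF x N(1)] ptrunc_integral[OF y N(2)]] by simp
  note coherent_digits[of "\<lambda>n. ptrunc p x n - ptrunc p y n", OF 1 2]
  then show "psub p x y \<in> qp p"
    "pcong p (n + 1) (ptrunc p (psub p x y) n) (ptrunc p x n - ptrunc p y n)"
    by (simp_all add: psub_def)
qed

text \<open>The product stabilizes: beyond index n - N the tail of x is a multiple of p^(n-N+1), and
  y is a multiple of p^N, so their product cannot reach digit n. The same holds with the factors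
  exchanged. This gives the definite description in \<open>pmul\<close> its value.\<close>

lemma pmul_digit:
  assumes x: "x \<in> qp p" and y: "y \<in> qp p"
    and xN: "\<And>k. k < M \<Longrightarrow> x k = 0" and yN: "\<And>k. k < N \<Longrightarrow> y k = 0"
  shows "pmul p x y n = pdig p (ptrunc p x (n - N) * ptrunc p y (n - M)) n"
proof -
  have *: "pdig p (ptrunc p x m * ptrunc p y m) n
      = pdig p (ptrunc p x (n - N) * ptrunc p y (n - M)) n"
    if "n - M \<le> m" "n - N \<le> m" for m
  proof (rule pdig_cong)
    have "pcong p (n - N + 1 + N) (ptrunc p x m * ptrunc p y m) (ptrunc p x (n - N) * ptrunc p y m)"
      by (intro pcong_mult ptrunc_cong ptrunc_integral x y yN that)
    moreover have "pcong p (n - M + 1 + M) (ptrunc p x (n - N) * ptrunc p y m)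
        (ptrunc p x (n - N) * ptrunc p y (n - M))"
      by (intro pcong_mult' ptrunc_cong ptrunc_integral x y xN that)
    ultimately show "pcong p (n + 1) (ptrunc p x m * ptrunc p y m)
        (ptrunc p x (n - N) * ptrunc p y (n - M))"
      using pcong_trans[of p "n + 1"] by (simp add: add.commute)
  qed
  have ev: "\<forall>\<^sub>F m in sequentially. pdig p (ptrunc p x (int m) * ptrunc p y (int m)) n
      = pdig p (ptrunc p x (n - N) * ptrunc p y (n - M)) n"
    using eventually_ge_at_top[of "nat (max (n - M) (n - N))"]
    by eventually_elim (rule *; linarith)
  show ?thesis unfolding pmul_def
  proof (rule the_equality)
    show "\<forall>\<^sub>F m in sequentially. pdig p (ptrunc p x (int m) * ptrunc p y (int m)) n
      = pdig p (ptrunc p x (n - N) * ptrunc p y (n - M)) n" by (rule ev)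
  next
    fix d assume "\<forall>\<^sub>F m in sequentially. pdig p (ptrunc p x (int m) * ptrunc p y (int m)) n = d"
    with ev have "\<forall>\<^sub>F m::nat in sequentially. d = pdig p (ptrunc p x (n - N) * ptrunc p y (n - M)) n"
      by eventually_elim simp
    then show "d = pdig p (ptrunc p x (n - N) * ptrunc p y (n - M)) n" by simp
  qed
qed

text \<open>The truncated products form a coherent sequence, because the tail dropped from one
  factor is compensated by the lowest exponent of the other.\<close>

lemma ptrunc_pmul:
  assumes x: "x \<in> qp p" and y: "y \<in> qp p"
    and xN: "\<And>k. k < M \<Longrightarrow> x k = 0" and yN: "\<And>k. k < N \<Longrightarrow> y k = 0"
  shows "pcong p (n + 1) (ptrunc p (pmul p x y) n) (ptrunc p x (n - N) * ptrunc p y (n - M))"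
proof -
  define r where "r n = ptrunc p x (n - N) * ptrunc p y (n - M)" for n
  have coh: "pcong p (n + 1) (r (n + 1)) (r n)" for n
  proof -
    have "pcong p (n - N + 1 + N) (r (n + 1)) (ptrunc p x (n - N) * ptrunc p y (n + 1 - M))"
      unfolding r_def by (intro pcong_mult ptrunc_cong ptrunc_integral x y yN) simp
    moreover have "pcong p (n - M + 1 + M) (ptrunc p x (n - N) * ptrunc p y (n + 1 - M)) (r n)"
      unfolding r_def by (intro pcong_mult' ptrunc_cong ptrunc_integral x y xN) simp
    ultimately show ?thesis using pcong_trans[of p "n + 1"] by (simp add: add.commute)
  qed
  have int: "pcong p (M + N) (r n) 0" for n
    unfolding r_def using pcong_mult[OF ptrunc_integral[OF x xN] ptrunc_integral[OF y yN]] by simp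
  have "(\<lambda>n. pdig p (r n) n) = pmul p x y"
    using pmul_digit[OF x y xN yN] by (simp add: fun_eq_iff r_def)
  then show ?thesis using coherent_digits(2)[of r, OF coh int, of n] by (simp add: r_def)
qed

lemma pmul_ppow:
  assumes y: "y \<in> qp p"
  shows "pmul p (ppow k) y n = y (n - k)"
proof -
  obtain N where N: "\<And>k. k < N \<Longrightarrow> y k = 0" using y qpE by blast
  have ppow: "ppow k \<in> qp p" using p_gt_1 by (auto simp: qp_def ppow_def)
  have pk: "ppow k i = 0" if "i < k" for i using that by (simp add: ppow_def)
  show ?thesis
  proof (cases "k \<le> n - N")
    case True
    have "{i. i \<le> n - N \<and> ppow k i \<noteq> 0} = {k}" using True by (auto simp: ppow_def)
    then have "ptrunc p (ppow k) (n - N) = real p powi k" by (simp add: ptrunc_def ppow_def)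
    then show ?thesis
      using pmul_digit[OF ppow y pk N] pdig_ptrunc[OF y, of "n - k" "n - k"]
      by (simp add: pdig_scale)
  next
    case False
    then have "ptrunc p (ppow k) (n - N) = 0" by (intro ptrunc_zero) (auto simp: ppow_def)
    then show ?thesis
      using pmul_digit[OF ppow y pk N] N[of "n - k"] False by (simp add: pdig_def)
  qed
qed

section \<open>Agreement of low-order digits, and balls\<close>

lemma ptrunc_agree: "(\<And>k. k < n \<Longrightarrow> x k = y k) \<Longrightarrow> ptrunc p x (n - 1) = ptrunc p y (n - 1)"
  unfolding ptrunc_def by (rule sum.cong) auto

text \<open>Truncations at n - 1 lie in [0, p^n), where congruence modulo p^n is equality. The index
  is n - 1 because \<open>ptrunc\<close> includes its last position.\<close>

lemma agree_iff_pcong: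
  assumes x: "x \<in> qp p" and y: "y \<in> qp p"
  shows "(\<forall>k<n. x k = y k) \<longleftrightarrow> pcong p n (ptrunc p x (n - 1)) (ptrunc p y (n - 1))"
proof
  assume "pcong p n (ptrunc p x (n - 1)) (ptrunc p y (n - 1))"
  then have "ptrunc p x (n - 1) = ptrunc p y (n - 1)"
    using ptrunc_bounds[OF x, of "n - 1"] ptrunc_bounds[OF y, of "n - 1"] by (intro pcong_eq) auto
  then show "\<forall>k<n. x k = y k"
    using pdig_ptrunc[OF x, of _ "n - 1"] pdig_ptrunc[OF y, of _ "n - 1"]
    by (metis zle_diff1_eq)
qed (metis ptrunc_agree pcong_refl)

lemma ptrunc_agreeD:
  assumes x: "x \<in> qp p" and y: "y \<in> qp p" and "ptrunc p x (n - 1) = ptrunc p y (n - 1)"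
  shows "\<forall>k<n. x k = y k"
  using assms agree_iff_pcong pcong_refl by metis

text \<open>Modulo p^n this is the equivalence of x - a = b and x = a + b. It stands in for the
  group laws: that subtraction undoes addition, and that translates of balls are balls, both follow
  from it.\<close>

lemma psub_agree_iff:
  assumes x: "x \<in> qp p" and a: "a \<in> qp p" and b: "b \<in> qp p"
  shows "(\<forall>k<n. psub p x a k = b k) \<longleftrightarrow> (\<forall>k<n. x k = padd p a b k)"
proof -
  let ?T = "\<lambda>x. ptrunc p x (n - 1)"
  have 1: "pcong p n (?T (psub p x a)) (?T x - ?T a)"
    using ptrunc_psub[OF x a, of "n - 1"] by simp
  have 2: "pcong p n (?T (padd p a b)) (?T a + ?T b)"
    using ptrunc_padd[OF a b, of "n - 1"] by simp
  have "(\<forall>k<n. psub p x a k = b k) \<longleftrightarrow> pcong p n (?T (psub p x a)) (?T b)"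
    by (intro agree_iff_pcong psub_qp x a b)
  also have "\<dots> \<longleftrightarrow> pcong p n (?T x - ?T a) (?T b)"
    using 1 pcong_sym pcong_trans by blast
  also have "\<dots> \<longleftrightarrow> pcong p n (?T x) (?T a + ?T b)"
    by (simp add: pcong_def algebra_simps)
  also have "\<dots> \<longleftrightarrow> pcong p n (?T x) (?T (padd p a b))"
    using 2 pcong_sym pcong_trans by blast
  also have "\<dots> \<longleftrightarrow> (\<forall>k<n. x k = padd p a b k)"
    by (intro agree_iff_pcong[symmetric] padd_qp x a b)
  finally show ?thesis .
qed

lemma padd_psub:
  assumes x: "x \<in> qp p" and a: "a \<in> qp p" shows "padd p a (psub p x a) = x"
proof
  fix n show "padd p a (psub p x a) n = x n"
    using psub_agree_iff[OF x a psub_qp[OF x a], of "n + 1"] by simp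
qed

lemma psub_padd:
  assumes x: "x \<in> qp p" and a: "a \<in> qp p" shows "psub p (padd p a x) a = x"
proof
  fix n show "psub p (padd p a x) a n = x n"
    using psub_agree_iff[OF padd_qp[OF a x] a x, of "n + 1"] by simp
qed

lemma psub_zero_iff:
  assumes x: "x \<in> qp p" and a: "a \<in> qp p"
  shows "(\<forall>k<n. psub p x a k = 0) \<longleftrightarrow> (\<forall>k<n. x k = a k)"
proof -
  have z: "pzero \<in> qp p" using p_gt_1 by (auto simp: qp_def pzero_def)
  have "padd p a pzero = a"
  proof
    fix n
    show "padd p a pzero n = a n"
      using pdig_ptrunc[OF a, of n n] by (simp add: padd_def ptrunc_zero pzero_def)
  qed
  then show ?thesis using psub_agree_iff[OF x a z, of n] by (simp add: pzero_def)
qed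

text \<open>As a ball, \<open>cyl n a\<close> has radius \<open>p ^ (- n)\<close>; mind the sign against \<open>pball\<close>.\<close>
definition cyl :: "int \<Rightarrow> (int \<Rightarrow> nat) \<Rightarrow> (int \<Rightarrow> nat) set" where
  "cyl n a = {x \<in> qp p. \<forall>k<n. x k = a k}"

lemma pnorm_le_iff:
  assumes "x \<in> qp p"
  shows "pnorm p x \<le> real p powi g \<longleftrightarrow> (\<forall>k< -g. x k = 0)"
proof (cases "x = pzero")
  case False
  obtain N where N: "\<And>k. k < N \<Longrightarrow> x k = 0" using assms qpE by blast
  obtain k0 where k0: "x k0 \<noteq> 0" using False by (auto simp: pzero_def)
  \<comment> \<open>The integers are not well-ordered; counting from N, below which all digits
    vanish, lets \<open>LEAST\<close> range over the naturals.\<close>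
  define m where "m = (LEAST i. x (N + int i) \<noteq> 0)"
  have "x (N + int (nat (k0 - N))) \<noteq> 0" using k0 N[of k0] by (cases "k0 < N") auto
  then have m: "x (N + int m) \<noteq> 0" and least: "\<And>i. i < m \<Longrightarrow> x (N + int i) = 0"
    unfolding m_def by (rule LeastI, use not_less_Least in blast)
  have below: "x i = 0" if "i < N + int m" for i
    using that N[of i] least[of "nat (i - N)"] by (cases "i < N") auto
  have v: "pval x = N + int m" unfolding pval_def
  proof (rule the_equality)
    show "x (N + int m) \<noteq> 0 \<and> (\<forall>i<N + int m. x i = 0)" using m below by blast
  next
    fix k assume "x k \<noteq> 0 \<and> (\<forall>i<k. x i = 0)"
    then show "k = N + int m" using m below by (metis linorder_neqE_linordered_idom)
  qed
  have "pnorm p x \<le> real p powi g \<longleftrightarrow> - pval x \<le> g"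
    using False p_gt_1 power_int_strict_increasing[of g "- pval x" "real p"]
      power_int_increasing[of "- pval x" g "real p"] by (auto simp: pnorm_def not_le)
  also have "\<dots> \<longleftrightarrow> (\<forall>k< -g. x k = 0)"
  proof
    assume "- pval x \<le> g"
    then show "\<forall>k< -g. x k = 0" using below v by simp
  next
    assume "\<forall>k< -g. x k = 0"
    then have "\<not> pval x < - g" using m v by metis
    then show "- pval x \<le> g" by simp
  qed
  finally show ?thesis .
qed (auto simp: pnorm_def pzero_def less_imp_le)

lemma pball_eq_cyl:
  assumes "a \<in> qp p" shows "pball p g a = cyl (- g) a"
  unfolding pball_def cyl_def
  using pnorm_le_iff[OF psub_qp[OF _ assms]] psub_zero_iff[OF _ assms] by blast

lemma pzero_qp: "pzero \<in> qp p"
  using p_gt_1 by (auto simp: qp_def pzero_def)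

lemma cyl_subset: "cyl n a \<subseteq> qp p"
  by (auto simp: cyl_def)



lemma cyl_eq: "b \<in> cyl n a \<Longrightarrow> cyl n b = cyl n a"
  by (auto simp: cyl_def)

lemma cyl_mono: "m \<le> n \<Longrightarrow> cyl n a \<subseteq> cyl m a"
  by (auto simp: cyl_def)

text \<open>Ultrametric balls are nested or disjoint. The disjoint case is the reason for adding the
  empty set to the generator in \<open>Int_stable_cyls\<close>.\<close>

lemma cyl_Int:
  assumes "n \<le> m" "b \<in> qp p"
  shows "cyl n a \<inter> cyl m b = (if b \<in> cyl n a then cyl m b else {})"
  using assms by (auto simp: cyl_def)

subsection \<open>Haar measure\<close>

abbreviation cyls :: "(int \<Rightarrow> nat) set set" where
  "cyls \<equiv> {cyl n a | n a. a \<in> qp p}"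

lemma balls_eq_cyls: "{pball p g a | g a. a \<in> qp p} = cyls"
proof -
  have "cyl n a \<in> {pball p g a | g a. a \<in> qp p}" if "a \<in> qp p" for n a
    using pball_eq_cyl[OF that, of "- n"] that by (intro CollectI exI[of _ "- n"] exI[of _ a]) simp
  moreover have "pball p g a \<in> cyls" if "a \<in> qp p" for g a
    using pball_eq_cyl[OF that, of g] that by blast
  ultimately show ?thesis by blast
qed

lemma cyls_Pow: "cyls \<subseteq> Pow (qp p)"
  using cyl_subset by blast

lemma Int_stable_cyls: "Int_stable (insert {} cyls)"
proof -
  have *: "cyl n a \<inter> cyl m b \<in> insert {} cyls" if "n \<le> m" "b \<in> qp p" for n m a b
    using cyl_Int[OF that, of a] that(2) by auto
  show ?thesis
  proof (rule Int_stableI)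
    fix A B assume "A \<in> insert {} cyls" "B \<in> insert {} cyls"
    then consider "A = {} \<or> B = {}"
      | n a m b where "A = cyl n a" "B = cyl m b" "a \<in> qp p" "b \<in> qp p" by blast
    then show "A \<inter> B \<in> insert {} cyls"
    proof cases
      case 2
      then show ?thesis
        using *[of n m b a] *[of m n a b] by (metis Int_commute linear)
    qed auto
  qed
qed

lemma Union_cyl_zero: "(\<Union>i. cyl (- int i) pzero) = qp p"
proof (intro equalityI subsetI)
  fix x assume x: "x \<in> qp p"
  then obtain N where "\<And>k. k < N \<Longrightarrow> x k = 0" using qpE by blast
  then have "x \<in> cyl (- int (nat (- N))) pzero" using x by (auto simp: cyl_def pzero_def)
  then show "x \<in> (\<Union>i. cyl (- int i) pzero)" by blast
qed (use cyl_subset in blast)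

definition qp_measure :: "(int \<Rightarrow> nat) measure \<Rightarrow> bool" where
  "qp_measure M \<longleftrightarrow> space M = qp p \<and> sets M = sigma_sets (qp p) cyls"

lemma qp_measure_cyl: "qp_measure M \<Longrightarrow> a \<in> qp p \<Longrightarrow> cyl n a \<in> sets M"
  by (auto simp: qp_measure_def)

lemma qp_measure_measurable:
  assumes "qp_measure N" "f \<in> space M \<rightarrow> qp p"
    and "\<And>n a. a \<in> qp p \<Longrightarrow> f -` cyl n a \<inter> space M \<in> sets M"
  shows "f \<in> measurable M N"
  using assms by (intro measurable_sigma_sets[where \<Omega> = "qp p" and A = cyls] cyls_Pow)
    (auto simp: qp_measure_def)

text \<open>The balls around zero of radius p^i exhaust the space and have finite measure, so the
  uniqueness theorem for intersection-stable generators applies.\<close>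

lemma qp_measure_eqI:
  assumes "qp_measure M" "qp_measure N"
    and "\<And>n a. a \<in> qp p \<Longrightarrow> emeasure M (cyl n a) = emeasure N (cyl n a)"
    and fin: "\<And>n. emeasure M (cyl n pzero) \<noteq> \<infinity>"
  shows "M = N"
proof (rule measure_eqI_generator_eq[where \<Omega> = "qp p" and E = "insert {} cyls"])
  have "sigma_sets (qp p) (insert {} cyls) = sigma_sets (qp p) cyls"
    by (rule sigma_sets_eqI) (auto intro: sigma_sets.intros)
  then show "sets M = sigma_sets (qp p) (insert {} cyls)"
    "sets N = sigma_sets (qp p) (insert {} cyls)"
    using assms by (auto simp: qp_measure_def)
  show "range (\<lambda>i. cyl (- int i) pzero) \<subseteq> insert {} cyls" using pzero_qp by blast
qed (use assms Int_stable_cyls cyls_Pow Union_cyl_zero in auto)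

text \<open>Reversing the base-\<open>p\<close> expansion of a nonnegative real gives a map onto almost all of the
  \<open>p\<close>-adic numbers under which balls correspond to intervals; Haar measure is the image of
  Lebesgue measure on \<open>[0, \<infinity>)\<close>.\<close>
definition realdig :: "real \<Rightarrow> int \<Rightarrow> nat" where
  "realdig r = (\<lambda>k. pdig p r (- k - 1))"

lemma realdig_eq: "realdig r k = nat (\<lfloor>r * real p powi (k + 1)\<rfloor> mod int p)"
proof -
  have "real p powi (- k - 1) = inverse (real p powi (k + 1))"
    using power_int_minus[of "real p" "k + 1"] by simp
  then show ?thesis by (simp add: realdig_def pdig_def divide_inverse)
qed

lemma realdig_vanish_iff:
  assumes r: "0 \<le> r"
  shows "(\<forall>k<n. realdig r k = 0) \<longleftrightarrow> r * real p powi n < 1"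
proof
  assume *: "r * real p powi n < 1"
  show "\<forall>k<n. realdig r k = 0"
  proof (intro allI impI)
    fix k assume "k < n"
    then have "r * real p powi (k + 1) \<le> r * real p powi n"
      using r p_gt_1 by (intro mult_left_mono power_int_increasing) auto
    then have "\<lfloor>r * real p powi (k + 1)\<rfloor> = 0" using * r by (intro floor_unique) auto
    then show "realdig r k = 0" by (simp add: realdig_eq)
  qed
next
  assume van: "\<forall>k<n. realdig r k = 0"
  show "r * real p powi n < 1"
  proof (rule ccontr)
    assume ge: "\<not> r * real p powi n < 1"
    \<comment> \<open>Lower the exponent until the scaled number falls below 1. The exponent just
      before that scales r into [1, p), which exposes a nonzero digit at a position below n.\<close>
    define Q where "Q i \<longleftrightarrow> r * real p powi (n - int i) < 1" for i
    obtain i where "r * real p powi n < real p ^ i"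
      using real_arch_pow[of "real p" "r * real p powi n"] p_gt_1 by auto
    then have "Q i"
      using p_gt_1 by (simp add: Q_def power_int_diff field_simps)
    moreover have "\<not> Q 0" using ge by (simp add: Q_def)
    ultimately obtain j where j: "\<not> Q j" "Q (Suc j)" using nat_induct[of "\<lambda>i. \<not> Q i" i] by blast
    define k where "k = n - int (Suc j)"
    have "r * real p powi (k + 1) = real p * (r * real p powi k)" by (simp add: powi_succ)
    also have "\<dots> < real p" using j(2) p_gt_1 by (simp add: Q_def k_def)
    finally have 1: "r * real p powi (k + 1) < real p" .
    have 2: "1 \<le> r * real p powi (k + 1)" using j(1) by (simp add: Q_def k_def)
    have "1 \<le> \<lfloor>r * real p powi (k + 1)\<rfloor>" "\<lfloor>r * real p powi (k + 1)\<rfloor> < int p"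
      using 1 2 by (simp_all add: floor_less_iff)
    then have "realdig r k \<noteq> 0" by (simp add: realdig_eq)
    then show False using van by (simp add: k_def)
  qed
qed

lemma realdig_qp:
  assumes "0 \<le> r" shows "realdig r \<in> qp p"
proof -
  obtain i where i: "r < real p ^ i" using real_arch_pow[of "real p" r] p_gt_1 by auto
  have "r * real p powi (- int i) < 1" using i p_gt_1 by (simp add: power_int_minus field_simps)
  then have "\<forall>k< - int i. realdig r k = 0" using realdig_vanish_iff assms by blast
  then show ?thesis by (auto simp: qp_def realdig_def pdig_less)
qed

text \<open>C is the sum of a k * p^(n-1-k) over k < n, that is, the digits of a below n read in
  reverse. Passing from n to n + 1 appends a n as the new last digit of the integer part.\<close>

lemma realdig_fiber:
  assumes a: "a \<in> qp p"
  shows "\<exists>C::nat. \<forall>r\<ge>0. (\<forall>k<n. realdig r k = a k) \<longleftrightarrow> \<lfloor>r * real p powi n\<rfloor> = int C"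
proof -
  obtain N where N: "\<And>k. k < N \<Longrightarrow> a k = 0" using a qpE by blast
  show ?thesis
  proof (induction n rule: int_induct_from_below[where N = N])
    case (1 n)
    have "(\<forall>k<n. realdig r k = a k) \<longleftrightarrow> \<lfloor>r * real p powi n\<rfloor> = int 0" if "0 \<le> r" for r
    proof -
      have "(\<forall>k<n. realdig r k = a k) \<longleftrightarrow> (\<forall>k<n. realdig r k = 0)" using N 1 by auto
      also have "\<dots> \<longleftrightarrow> r * real p powi n < 1" by (rule realdig_vanish_iff[OF that])
      also have "\<dots> \<longleftrightarrow> \<lfloor>r * real p powi n\<rfloor> = int 0"
        using that by (simp add: floor_eq_iff)
      finally show ?thesis .
    qed
    then show ?case by blast
  next
    case (2 n)
    then obtain C :: nat where
      C: "\<And>r. 0 \<le> r \<Longrightarrow> (\<forall>k<n. realdig r k = a k) \<longleftrightarrow> \<lfloor>r * real p powi n\<rfloor> = int C" by blast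
    have "(\<forall>k<n + 1. realdig r k = a k) \<longleftrightarrow> \<lfloor>r * real p powi (n + 1)\<rfloor> = int (C * p + a n)"
      if r: "0 \<le> r" for r
    proof -
      define u where "u = \<lfloor>r * real p powi (n + 1)\<rfloor>"
      have "r * real p powi n = r * real p powi (n + 1) / real_of_int (int p)"
        by (simp add: powi_succ)
      then have "\<lfloor>r * real p powi n\<rfloor> = u div int p"
        unfolding u_def by (simp only: floor_divide_real_eq_div[of "int p"] of_nat_0_le_iff)
      moreover have "realdig r n = a n \<longleftrightarrow> u mod int p = int (a n)"
      proof -
        have "int (realdig r n) = u mod int p" using p_gt_1 by (simp add: realdig_eq u_def)
        then show ?thesis by (metis of_nat_eq_iff)
      qed
      moreover have "(\<forall>k<n + 1. realdig r k = a k) \<longleftrightarrow>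
          (\<forall>k<n. realdig r k = a k) \<and> realdig r n = a n"
        by (auto simp: order.order_iff_strict)
      ultimately have "(\<forall>k<n + 1. realdig r k = a k) \<longleftrightarrow>
          u div int p = int C \<and> u mod int p = int (a n)"
        using C[OF r] by simp
      also have "\<dots> \<longleftrightarrow> u = int (C * p + a n)"
      proof
        assume "u div int p = int C \<and> u mod int p = int (a n)"
        then show "u = int (C * p + a n)" using div_mult_mod_eq[of u "int p"] by simp
      next
        assume "u = int (C * p + a n)"
        then have "u = int (a n) + int C * int p" by simp
        moreover have "int (a n) < int p" using qp_digit_less[OF a] by simp
        ultimately show "u div int p = int C \<and> u mod int p = int (a n)"
          by (simp only: div_mult_self1 mod_mult_self1) simp
      qed
      finally show ?thesis by (simp only: u_def)
    qed
    then show ?case by blast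
  qed
qed

lemma realdig_vimage_cyl:
  assumes a: "a \<in> qp p"
  obtains C :: nat where
    "realdig -` cyl n a \<inter> {0..} = {real C * real p powi (- n) ..< (real C + 1) * real p powi (- n)}"
proof -
  obtain C :: nat where
    C: "\<And>r. 0 \<le> r \<Longrightarrow> (\<forall>k<n. realdig r k = a k) \<longleftrightarrow> \<lfloor>r * real p powi n\<rfloor> = int C"
    using realdig_fiber[OF a] by blast
  have "r \<in> realdig -` cyl n a \<inter> {0..} \<longleftrightarrow>
      r \<in> {real C * real p powi (- n) ..< (real C + 1) * real p powi (- n)}" for r
  proof -
    have "0 \<le> r" if "real C * real p powi (- n) \<le> r"
      using that powi_pos[of "- n"] by (meson mult_nonneg_nonneg of_nat_0_le_iff less_imp_le order_trans)
    then show ?thesis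
      using C[of r] realdig_qp[of r]
      by (auto simp: cyl_def floor_eq_iff power_int_minus field_simps)
  qed
  then show ?thesis using that by blast
qed

definition mu :: "(int \<Rightarrow> nat) measure" where
  "mu = distr (restrict_space lborel {0..}) (sigma (qp p) cyls) realdig"

lemma qp_measure_sigma: "qp_measure (sigma (qp p) cyls)"
  using cyls_Pow by (simp add: qp_measure_def)

lemma qp_measure_mu: "qp_measure mu"
  using qp_measure_sigma by (simp add: mu_def qp_measure_def)

lemma measurable_realdig: "realdig \<in> measurable (restrict_space lborel {0..}) (sigma (qp p) cyls)"
proof (rule qp_measure_measurable[OF qp_measure_sigma])
  fix n a assume "a \<in> qp p"
  then obtain C :: nat where "realdig -` cyl n a \<inter> {0..} =
      {real C * real p powi (- n) ..< (real C + 1) * real p powi (- n)}"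
    by (rule realdig_vimage_cyl[where n = n])
  then have "realdig -` cyl n a \<inter> {0..} \<in> sets lborel" by simp
  then show "realdig -` cyl n a \<inter> space (restrict_space lborel {0..})
      \<in> sets (restrict_space lborel {0..})"
    by (simp add: sets_restrict_space_iff space_restrict_space)
qed (auto simp: space_restrict_space realdig_qp)

lemma emeasure_mu_cyl:
  assumes a: "a \<in> qp p"
  shows "emeasure mu (cyl n a) = ennreal (real p powi (- n))"
proof -
  obtain C :: nat where C: "realdig -` cyl n a \<inter> {0..} =
      {real C * real p powi (- n) ..< (real C + 1) * real p powi (- n)}"
    using a by (rule realdig_vimage_cyl[where n = n])
  have "emeasure mu (cyl n a) = emeasure (restrict_space lborel {0..}) (realdig -` cyl n a \<inter> {0..})"
    unfolding mu_def using qp_measure_cyl[OF qp_measure_sigma a]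
    by (subst emeasure_distr[OF measurable_realdig]) (simp_all add: space_restrict_space)
  also have "\<dots> = emeasure lborel (realdig -` cyl n a \<inter> {0..})"
    by (rule emeasure_restrict_space) auto
  also have "\<dots> = ennreal (real p powi (- n))"
    unfolding C by (subst emeasure_lborel_Ico) (auto simp: algebra_simps less_imp_le)
  finally show ?thesis .
qed

text \<open>Invariance is stated with images, whereas measurability and \<open>distr\<close> work
  with preimages; subtraction of a translates between the two.\<close>

lemma padd_image:
  assumes a: "a \<in> qp p" and "A \<subseteq> qp p"
  shows "padd p a ` A = (\<lambda>x. psub p x a) -` A \<inter> qp p"
proof (intro equalityI subsetI)
  fix x assume "x \<in> padd p a ` A"
  then show "x \<in> (\<lambda>x. psub p x a) -` A \<inter> qp p"
    using assms padd_qp psub_padd by auto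
next
  fix x assume "x \<in> (\<lambda>x. psub p x a) -` A \<inter> qp p"
  then show "x \<in> padd p a ` A" using padd_psub[OF _ a, of x] by (metis IntE image_eqI vimageD)
qed

lemma psub_vimage_cyl:
  assumes "a \<in> qp p" "b \<in> qp p"
  shows "(\<lambda>x. psub p x a) -` cyl n b \<inter> qp p = cyl n (padd p a b)"
  using psub_agree_iff[OF _ assms] psub_qp[OF _ assms(1)] by (auto simp: cyl_def)

lemma padd_image_cyl:
  assumes "a \<in> qp p" "b \<in> qp p"
  shows "padd p a ` cyl n b = cyl n (padd p a b)"
  using padd_image[OF assms(1) cyl_subset] psub_vimage_cyl[OF assms] by metis

text \<open>A translate of a ball is a ball of the same radius, so \<open>mu\<close> and its image
  under translation agree on balls and hence everywhere.\<close>

lemma mu_invariant: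
  assumes a: "a \<in> qp p" and A: "A \<in> sets mu"
  shows "emeasure mu (padd p a ` A) = emeasure mu A"
proof -
  have sp: "space mu = qp p" using qp_measure_mu by (simp add: qp_measure_def)
  have m: "(\<lambda>x. psub p x a) \<in> measurable mu mu"
    using psub_vimage_cyl[OF a] qp_measure_cyl[OF qp_measure_mu padd_qp[OF a]] psub_qp[OF _ a]
    by (intro qp_measure_measurable[OF qp_measure_mu]) (auto simp: sp)
  have "mu = distr mu mu (\<lambda>x. psub p x a)"
  proof (rule qp_measure_eqI[OF qp_measure_mu])
    show "qp_measure (distr mu mu (\<lambda>x. psub p x a))"
      using qp_measure_mu by (simp add: qp_measure_def)
    fix n b assume b: "b \<in> qp p"
    show "emeasure mu (cyl n b) = emeasure (distr mu mu (\<lambda>x. psub p x a)) (cyl n b)"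
      using emeasure_distr[OF m qp_measure_cyl[OF qp_measure_mu b]] psub_vimage_cyl[OF a b]
        emeasure_mu_cyl padd_qp[OF a b] b sp by simp
  qed (simp add: emeasure_mu_cyl pzero_qp)
  then have "emeasure mu A = emeasure (distr mu mu (\<lambda>x. psub p x a)) A" by simp
  also have "\<dots> = emeasure mu ((\<lambda>x. psub p x a) -` A \<inter> qp p)"
    using emeasure_distr[OF m A] by (simp add: sp)
  also have "\<dots> = emeasure mu (padd p a ` A)"
    using padd_image[OF a] sets.sets_into_space[OF A] sp by simp
  finally show ?thesis by simp
qed

text \<open>The number d * p^n. For d < p these represent the p balls of the next smaller radius
  inside \<open>cyl n pzero\<close>.\<close>

definition digit_at :: "int \<Rightarrow> nat \<Rightarrow> int \<Rightarrow> nat" where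
  "digit_at n d = (\<lambda>k. if k = n then d else 0)"

lemma digit_at_qp: "d < p \<Longrightarrow> digit_at n d \<in> qp p"
  using p_gt_1 unfolding qp_def digit_at_def by (auto intro!: exI[of _ n])

lemma cyl_zero_split: "cyl n pzero = (\<Union>d<p. cyl (n + 1) (digit_at n d))"
  by (auto simp: cyl_def pzero_def digit_at_def zless_add1_eq qp_digit_less)

lemma disjoint_digit_cyls: "disjoint_family_on (\<lambda>d. cyl (n + 1) (digit_at n d)) {..<p}"
  unfolding disjoint_family_on_def
proof (intro ballI impI)
  fix d e :: nat assume "d \<noteq> e"
  then show "cyl (n + 1) (digit_at n d) \<inter> cyl (n + 1) (digit_at n e) = {}"
    unfolding cyl_def digit_at_def by (auto dest!: spec[of _ n])
qed

text \<open>\<open>cyl n pzero\<close> is tiled by p translates of \<open>cyl (n + 1) pzero\<close>,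
  so invariance gives c n = p * c (n + 1). With the normalization at n = 0, induction in both
  directions fixes the measure of every ball.\<close>

lemma invariant_measure_unique:
  assumes M: "qp_measure M"
    and inv: "\<And>a A. a \<in> qp p \<Longrightarrow> A \<in> sets M \<Longrightarrow> emeasure M (padd p a ` A) = emeasure M A"
    and norm: "emeasure M (cyl 0 pzero) = 1"
  shows "M = mu"
proof -
  define c where "c n = emeasure M (cyl n pzero)" for n
  have pz: "padd p a pzero = a" if a: "a \<in> qp p" for a
    using psub_zero_iff[OF that that] psub_agree_iff[OF a a pzero_qp]
    by (auto simp: pzero_def fun_eq_iff) (metis lt_ex gt_ex)
  have cyl: "emeasure M (cyl n a) = c n" if "a \<in> qp p" for n a
    using inv[OF that qp_measure_cyl[OF M pzero_qp]] padd_image_cyl[OF that pzero_qp] pz[OF that]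
    by (simp add: c_def)
  have step: "c n = of_nat p * c (n + 1)" for n
  proof -
    have "c n = (\<Sum>d<p. emeasure M (cyl (n + 1) (digit_at n d)))"
      unfolding c_def cyl_zero_split using disjoint_digit_cyls
      by (intro sum_emeasure[symmetric]) (auto intro: qp_measure_cyl[OF M] digit_at_qp)
    also have "\<dots> = (\<Sum>d<p. c (n + 1))" by (intro sum.cong cyl digit_at_qp) auto
    finally show ?thesis by simp
  qed
  have c: "c n = ennreal (real p powi (- n))" for n
  proof (induction n rule: int_induct[where k = 0])
    case base then show ?case using norm by (simp add: c_def)
  next
    case (step1 i)
    have "of_nat p * c (i + 1) = of_nat p * ennreal (real p powi (- (i + 1)))"
      using step[of i] step1 powi_succ[of "- (i + 1)"]
      by (simp add: ennreal_of_nat_eq_real_of_nat flip: ennreal_mult)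
    then show ?case using p_gt_1
      by (subst (asm) ennreal_mult_cancel_left) (auto simp: ennreal_of_nat_eq_real_of_nat)
  next
    case (step2 i)
    then show ?case using step[of "i - 1"] powi_succ[of "- i"]
      by (simp add: ennreal_of_nat_eq_real_of_nat flip: ennreal_mult)
  qed
  show ?thesis
    by (rule qp_measure_eqI[OF M qp_measure_mu])
      (simp_all add: cyl c emeasure_mu_cyl pzero_qp)
qed

lemma haar_eq_mu: "haar p = mu"
  unfolding haar_def
proof (rule the_equality)
  show "space mu = qp p \<and> sets mu = sigma_sets (qp p) {pball p \<gamma> a | \<gamma> a. a \<in> qp p}
      \<and> (\<forall>a\<in>qp p. \<forall>A\<in>sets mu. emeasure mu (padd p a ` A) = emeasure mu A)
      \<and> emeasure mu (pball p 0 pzero) = 1"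
    using qp_measure_mu mu_invariant balls_eq_cyls pball_eq_cyl[OF pzero_qp] emeasure_mu_cyl pzero_qp
    by (simp add: qp_measure_def)
next
  fix M assume "space M = qp p \<and> sets M = sigma_sets (qp p) {pball p \<gamma> a | \<gamma> a. a \<in> qp p}
      \<and> (\<forall>a\<in>qp p. \<forall>A\<in>sets M. emeasure M (padd p a ` A) = emeasure M A)
      \<and> emeasure M (pball p 0 pzero) = 1"
  then show "M = mu"
    using balls_eq_cyls pball_eq_cyl[OF pzero_qp, of 0]
    by (intro invariant_measure_unique) (auto simp: qp_measure_def)
qed

lemma qp_measure_haar: "qp_measure (haar p)"
  by (simp add: haar_eq_mu qp_measure_mu)

lemma space_haar [simp]: "space (haar p) = qp p"
  using qp_measure_haar by (simp add: qp_measure_def)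

lemma emeasure_haar_cyl: "a \<in> qp p \<Longrightarrow> emeasure (haar p) (cyl n a) = ennreal (real p powi (- n))"
  by (simp add: haar_eq_mu emeasure_mu_cyl)

lemma cyl_sets [measurable]: "a \<in> qp p \<Longrightarrow> cyl n a \<in> sets (haar p)"
  by (rule qp_measure_cyl[OF qp_measure_haar])

subsection \<open>Integrals over balls\<close>

lemma emeasure_haar_cyl_finite: "a \<in> qp p \<Longrightarrow> emeasure (haar p) (cyl n a) < \<infinity>"
  by (simp add: emeasure_haar_cyl)

text \<open>Balls have finite measure, and t <= 1 + t^2 bounds |f| on the ball by an integrable
  function.\<close>

lemma pL2_set_integrable:
  assumes f: "pL2 p f" and a: "a \<in> qp p"
  shows "set_integrable (haar p) (cyl n a) f"
  unfolding set_integrable_def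
proof (rule Bochner_Integration.integrable_bound)
  have "integrable (haar p) (indicator (cyl n a) :: _ \<Rightarrow> real)"
    using emeasure_haar_cyl_finite[OF a] a by (intro integrable_real_indicator) auto
  then show "integrable (haar p) (\<lambda>x. indicator (cyl n a) x + (cmod (f x))\<^sup>2)"
    using f by (simp add: pL2_def)
  show "(\<lambda>x. indicator (cyl n a) x *\<^sub>R f x) \<in> borel_measurable (haar p)"
    using f a by (intro borel_measurable_scaleR borel_measurable_indicator) (auto simp: pL2_def)
  have "t \<le> 1 + t\<^sup>2" for t :: real
    using sum_squares_bound[of t 1] zero_le_power2[of t] by (cases "0 \<le> t") (auto intro: order_trans[of _ 0])
  then show "AE x in haar p. norm (indicator (cyl n a) x *\<^sub>R f x)
      \<le> norm (indicator (cyl n a) x + (cmod (f x))\<^sup>2)"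
    by (auto simp: indicator_def)
qed

text \<open>A truncation takes countably many values, all in Z[1/p], and each of its fibres is a
  ball or empty. So it is measurable into a discrete space, and g can be any function.\<close>

lemma measurable_ptrunc:
  fixes g :: "real \<Rightarrow> 'b::topological_space"
  shows "(\<lambda>x. g (ptrunc p x n)) \<in> borel_measurable (haar p)"
proof -
  define A where "A = range (\<lambda>(z::int, N). of_int z * real p powi N)"
  have "countable A" by (simp add: A_def)
  have "ptrunc p x n \<in> A" if x: "x \<in> qp p" for x
  proof -
    obtain N where "\<And>k. k < N \<Longrightarrow> x k = 0" using x qpE by blast
    then obtain z :: int where "ptrunc p x n = of_int z * real p powi N"
      using ptrunc_integral[OF x] unfolding pcong_def by force
    then show ?thesis unfolding A_def by auto
  qed
  moreover have "(\<lambda>x. ptrunc p x n) -` {c} \<inter> qp p \<in> sets (haar p)" for c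
  proof (cases "\<exists>a\<in>qp p. ptrunc p a n = c")
    case True
    then obtain a where a: "a \<in> qp p" "ptrunc p a n = c" by blast
    have "(\<lambda>x. ptrunc p x n) -` {c} \<inter> qp p = cyl (n + 1) a"
      using ptrunc_agreeD[OF _ a(1), of _ "n + 1"] ptrunc_agree[of "n + 1" _ a] a(2)
      by (auto simp: cyl_def)
    then show ?thesis using a by simp
  next
    case False
    then have "(\<lambda>x. ptrunc p x n) -` {c} \<inter> qp p = {}" by auto
    then show ?thesis by simp
  qed
  ultimately have "(\<lambda>x. ptrunc p x n) \<in> measurable (haar p) (count_space A)"
    using \<open>countable A\<close> by (subst measurable_count_space_eq_countable) auto
  then have "(\<lambda>x. g (ptrunc p x n)) \<in> measurable (haar p) borel"
    by (rule measurable_compose) simp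
  then show ?thesis .
qed

section \<open>The substitution x -> p^(-j) x - b\<close>

definition affine :: "int \<Rightarrow> (int \<Rightarrow> nat) \<Rightarrow> (int \<Rightarrow> nat) \<Rightarrow> (int \<Rightarrow> nat)" where
  "affine j b x = psub p (pmul p (ppow (- j)) x) b"

lemma shift_qp: "x \<in> qp p \<Longrightarrow> (\<lambda>k. x (k + j)) \<in> qp p"
proof -
  assume x: "x \<in> qp p"
  then obtain N where "\<And>k. k < N \<Longrightarrow> x k = 0" using qpE by blast
  then show ?thesis using x by (auto simp: qp_def intro!: exI[of _ "N - j"])
qed

lemma pmul_ppow_eq_shift: "x \<in> qp p \<Longrightarrow> pmul p (ppow (- j)) x = (\<lambda>k. x (k + j))"
  using pmul_ppow[of x "- j"] by auto

lemma affine_qp: "b \<in> qp p \<Longrightarrow> x \<in> qp p \<Longrightarrow> affine j b x \<in> qp p"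
  by (simp add: affine_def pmul_ppow_eq_shift psub_qp shift_qp)

text \<open>Multiplication by p^(-j) moves digit k + j to position k, so positions below n after the
  substitution are positions below n + j before it.\<close>

lemma affine_agree_iff:
  assumes x: "x \<in> qp p" and b: "b \<in> qp p" and c: "c \<in> qp p"
  shows "(\<forall>k<n. affine j b x k = c k) \<longleftrightarrow> (\<forall>k<n + j. x k = padd p b c (k - j))"
proof -
  have "(\<forall>k<n. affine j b x k = c k) \<longleftrightarrow> (\<forall>k<n. x (k + j) = padd p b c k)"
    unfolding affine_def pmul_ppow_eq_shift[OF x] by (rule psub_agree_iff[OF shift_qp[OF x] b c])
  also have "\<dots> \<longleftrightarrow> (\<forall>k<n + j. x k = padd p b c (k - j))"
    by (metis add_diff_cancel diff_add_cancel diff_less_eq less_diff_eq)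
  finally show ?thesis .
qed

lemma affine_vimage_cyl:
  assumes b: "b \<in> qp p" and c: "c \<in> qp p"
  shows "affine j b -` cyl n c \<inter> qp p = cyl (n + j) (\<lambda>k. padd p b c (k - j))"
  using affine_agree_iff[OF _ b c] affine_qp[OF b] by (auto simp: cyl_def)

lemma affine_mem_cyl_iff:
  assumes b: "b \<in> qp p" and x: "x \<in> qp p" and a: "a \<in> qp p"
  shows "affine j b x \<in> cyl (n - j) (affine j b a) \<longleftrightarrow> x \<in> cyl n a"
  using affine_agree_iff[OF x b affine_qp[OF b a], of "n - j" j j]
    affine_agree_iff[OF a b affine_qp[OF b a], of "n - j" j j] affine_qp[OF b x] x
  by (simp add: cyl_def)

lemma affine_measurable: "b \<in> qp p \<Longrightarrow> affine j b \<in> measurable (haar p) (haar p)"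
  using affine_vimage_cyl[of b] shift_qp[OF padd_qp, of b _ "- j"] affine_qp
  by (intro qp_measure_measurable[OF qp_measure_haar]) auto

text \<open>The preimage of a ball of radius p^(-n) is a ball of radius p^(-n-j), so the two
  measures agree on balls. The factor is the inverse of |p^(-j)|_p = p^j, as for any image measure
  under a dilation.\<close>

lemma distr_affine:
  assumes b: "b \<in> qp p"
  shows "distr (haar p) (haar p) (affine j b)
    = density (haar p) (\<lambda>_. ennreal (real p powi (- j)))"
proof (rule qp_measure_eqI)
  have eq: "emeasure (distr (haar p) (haar p) (affine j b)) (cyl n a)
      = ennreal (real p powi (- (n + j)))" if a: "a \<in> qp p" for n a
    using emeasure_distr[OF affine_measurable[OF b] cyl_sets[OF a]] affine_vimage_cyl[OF b a]
      emeasure_haar_cyl shift_qp[OF padd_qp[OF b a], of "- j"] by simp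
  then show "emeasure (distr (haar p) (haar p) (affine j b)) (cyl n pzero) \<noteq> \<infinity>" for n
    by (simp add: pzero_qp)
  fix n a assume a: "a \<in> qp p"
  show "emeasure (distr (haar p) (haar p) (affine j b)) (cyl n a)
      = emeasure (density (haar p) (\<lambda>_. ennreal (real p powi (- j)))) (cyl n a)"
    unfolding eq[OF a]
    using powi_add[of "- j" "- n"] emeasure_haar_cyl[OF a, of n]
    by (simp add: emeasure_density_const a ennreal_mult' less_imp_le algebra_simps)
qed (use qp_measure_haar in \<open>simp_all add: qp_measure_def\<close>)

lemma set_integral_affine:
  assumes f: "pL2 p f" and b: "b \<in> qp p" and a: "a \<in> qp p"
  shows "set_integrable (haar p) (cyl n a) (\<lambda>x. f (affine j b x))"
    and "(LINT x:cyl n a|haar p. f (affine j b x))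
      = (real p powi (- j)) *\<^sub>R (LINT x:cyl (n - j) (affine j b a)|haar p. f x)"
proof -
  define h where "h x = indicator (cyl (n - j) (affine j b a)) x *\<^sub>R f x" for x
  have int: "integrable (haar p) h"
    using pL2_set_integrable[OF f affine_qp[OF b a]] by (simp add: h_def[abs_def] set_integrable_def)
  have [measurable]: "h \<in> borel_measurable (haar p)" using int by simp
  note [measurable] = affine_measurable[OF b]
  have h: "h (affine j b x) = indicator (cyl n a) x *\<^sub>R f (affine j b x)" if "x \<in> qp p" for x
    using affine_mem_cyl_iff[OF b that a] by (simp add: h_def indicator_def)
  have "integrable (density (haar p) (\<lambda>_. ennreal (real p powi (- j)))) h"
    using int by (subst integrable_density) (auto simp: less_imp_le)
  then have "integrable (haar p) (\<lambda>x. h (affine j b x))"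
    unfolding distr_affine[OF b, symmetric] by (subst (asm) integrable_distr_eq) auto
  then show "set_integrable (haar p) (cyl n a) (\<lambda>x. f (affine j b x))"
    unfolding set_integrable_def
    by (rule Bochner_Integration.integrable_cong[THEN iffD1, rotated -1]) (auto simp: h)
  have "(LINT x:cyl n a|haar p. f (affine j b x)) = (LINT x|haar p. h (affine j b x))"
    unfolding set_lebesgue_integral_def by (rule Bochner_Integration.integral_cong) (auto simp: h)
  also have "\<dots> = integral\<^sup>L (density (haar p) (\<lambda>_. ennreal (real p powi (- j)))) h"
    unfolding distr_affine[OF b, symmetric] by (subst integral_distr) auto
  also have "\<dots> = (LINT x|haar p. (real p powi (- j)) *\<^sub>R h x)"
    by (subst integral_density) (auto simp: less_imp_le)
  also have "\<dots> = (real p powi (- j)) *\<^sub>R (LINT x:cyl (n - j) (affine j b a)|haar p. f x)"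
    by (simp only: h_def set_lebesgue_integral_def integral_scaleR_right)
  finally show "(LINT x:cyl n a|haar p. f (affine j b x))
      = (real p powi (- j)) *\<^sub>R (LINT x:cyl (n - j) (affine j b a)|haar p. f x)" .
qed

text \<open>No limit in j is actually taken: a given pair of centres is settled by a single j and by
  approximations of f from that one space. All summands of such an approximation have equal
  integrals over the two balls, and Cauchy-Schwarz transfers this to f up to an arbitrary e.\<close>

lemma pV_cyl_integral_eq:
  assumes \<phi>: "pL2 p \<phi>"
    and inv: "\<And>m a a'. a \<in> qp p \<Longrightarrow> a' \<in> qp p \<Longrightarrow> \<forall>k<\<gamma>. a k = a' k \<Longrightarrow>
      (LINT x:cyl m a|haar p. \<phi> x) = (LINT x:cyl m a'|haar p. \<phi> x)"
    and f: "pL2 p f" and V: "\<And>j. pV p \<phi> j f"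
    and a: "a \<in> qp p" and a': "a' \<in> qp p"
  shows "(LINT x:cyl m a|haar p. f x) = (LINT x:cyl m a'|haar p. f x)"
proof -
  obtain N where N: "\<And>k. k < N \<Longrightarrow> a k = 0" "\<And>k. k < N \<Longrightarrow> a' k = 0"
    using qp_common_bound[OF a a'] by blast
  \<comment> \<open>Both centres have only zero digits below N and so agree there. For every b,
    \<open>affine j b\<close> turns this into agreement below N - j = \<gamma>, as
    \<open>inv\<close> requires.\<close>
  define j where "j = N - \<gamma>"
  let ?I = "\<lambda>f a. LINT x:cyl m a|haar p. f x"
  define C where "C = real p powi (- m)"
  have close: "cmod (?I f a - ?I f a') \<le> e" if e: "0 < e" for e
  proof -
    \<comment> \<open>C is the measure of each ball and \<open>pdist2\<close> is a squared distance,
      so this choice makes the error at most e / 2 on each of the two balls.\<close>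
    define \<epsilon> where "\<epsilon> = (e / 2)\<^sup>2 / C"
    have \<epsilon>: "0 < \<epsilon>" "C * \<epsilon> = (e / 2)\<^sup>2" using e by (simp_all add: \<epsilon>_def C_def)
    obtain A c where A: "finite A" "A \<subseteq> Ip p"
      and dist: "pdist2 p f (\<lambda>x. \<Sum>b\<in>A. c b * \<phi> (affine j b x)) < ennreal \<epsilon>"
      using V[of j] \<epsilon> unfolding pV_def affine_def by blast
    define g where "g x = (\<Sum>b\<in>A. c b * \<phi> (affine j b x))" for x
    have Aq: "b \<in> qp p" if "b \<in> A" for b using A that by (auto simp: Ip_def)
    have gint: "set_integrable (haar p) (cyl m a) g"
      and gI: "?I g a = (\<Sum>b\<in>A. c b * ?I (\<lambda>x. \<phi> (affine j b x)) a)" if a: "a \<in> qp p" for a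
    proof -
      have i: "integrable (haar p) (\<lambda>x. indicator (cyl m a) x *\<^sub>R \<phi> (affine j b x))" if "b \<in> A" for b
        using set_integral_affine(1)[OF \<phi> Aq[OF that] a] by (simp add: set_integrable_def)
      have eq: "indicator (cyl m a) x *\<^sub>R g x
          = (\<Sum>b\<in>A. c b * (indicator (cyl m a) x *\<^sub>R \<phi> (affine j b x)))" for x
        by (simp add: g_def scaleR_sum_right)
      show "set_integrable (haar p) (cyl m a) g"
        unfolding set_integrable_def eq using i
        by (intro Bochner_Integration.integrable_sum integrable_mult_right)
      show "?I g a = (\<Sum>b\<in>A. c b * ?I (\<lambda>x. \<phi> (affine j b x)) a)"
        unfolding set_lebesgue_integral_def eq
        by (subst Bochner_Integration.integral_sum, intro integrable_mult_right i, assumption)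
          (simp only: integral_mult_right_zero)
    qed
    have "?I (\<lambda>x. \<phi> (affine j b x)) a = ?I (\<lambda>x. \<phi> (affine j b x)) a'" if "b \<in> A" for b
    proof -
      have b: "b \<in> qp p" using Aq that .
      have "affine j b a \<in> cyl (N - j) (affine j b a')"
        using affine_mem_cyl_iff[OF b a a', of j N] N a by (simp add: cyl_def)
      then have "\<forall>k<\<gamma>. affine j b a k = affine j b a' k" by (simp add: cyl_def j_def)
      then show ?thesis
        using inv[OF affine_qp[OF b a] affine_qp[OF b a']] set_integral_affine(2)[OF \<phi> b]
        by (simp add: a a')
    qed
    then have gg: "?I g a = ?I g a'" by (simp add: gI a a')
    have bound: "cmod (?I f b - ?I g b) \<le> e / 2"
      if gb: "set_integrable (haar p) (cyl m b) g" and b: "b \<in> qp p" for b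
    proof -
      have "ennreal ((cmod (?I f b - ?I g b))\<^sup>2) \<le> emeasure (haar p) (cyl m b) * pdist2 p f g"
        unfolding pdist2_def using gb pL2_set_integrable[OF f b] b
        by (intro sq_norm_set_integral_diff_le) auto
      also have "\<dots> \<le> ennreal C * ennreal \<epsilon>"
        using dist b by (intro mult_mono) (auto simp: emeasure_haar_cyl C_def g_def[abs_def])
      also have "\<dots> = ennreal ((e / 2)\<^sup>2)" using \<epsilon> by (simp add: C_def less_imp_le flip: ennreal_mult)
      finally show ?thesis using e by (simp add: power2_le_iff_abs_le)
    qed
    have "cmod (?I f a - ?I f a') \<le> cmod (?I f a - ?I g a) + cmod (?I f a' - ?I g a')"
      unfolding gg using norm_triangle_ineq4[of "?I f a - ?I g a'" "?I f a' - ?I g a'"] by simp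
    also have "\<dots> \<le> e" using bound[OF gint[OF a] a] bound[OF gint[OF a'] a'] by simp
    finally show ?thesis .
  qed
  show ?thesis
  proof (rule ccontr)
    assume "?I f a \<noteq> ?I f a'"
    then have pos: "0 < cmod (?I f a - ?I f a')"
      unfolding zero_less_norm_iff right_minus_eq .
    then have "cmod (?I f a - ?I f a') \<le> cmod (?I f a - ?I f a') / 2"
      by (intro close half_gt_zero)
    then show False using pos by linarith
  qed
qed

text \<open>A ball that is p^i times larger splits into p^i balls with equal integrals, so the
  square of its integral grows like p^(2i), while Cauchy-Schwarz allows only growth like
  p^i.\<close>

lemma cyl_integrals_const_zero:
  assumes f: "pL2 p f"
    and const: "\<And>m a a'. a \<in> qp p \<Longrightarrow> a' \<in> qp p \<Longrightarrow>
      (LINT x:cyl m a|haar p. f x) = (LINT x:cyl m a'|haar p. f x)"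
    and a: "a \<in> qp p"
  shows "(LINT x:cyl m a|haar p. f x) = 0"
proof -
  define I where "I n = (LINT x:cyl n pzero|haar p. f x)" for n
  define D where "D = (LINT x|haar p. (cmod (f x))\<^sup>2)"
  have D: "pdist2 p f (\<lambda>_. 0) = ennreal D"
    using f unfolding pdist2_def D_def pL2_def by (subst nn_integral_eq_integral) auto
  have bound: "(cmod (I n))\<^sup>2 \<le> real p powi (- n) * D" for n
  proof -
    have "ennreal ((cmod (I n - (LINT x:cyl n pzero|haar p. 0)))\<^sup>2)
        \<le> emeasure (haar p) (cyl n pzero) * pdist2 p f (\<lambda>_. 0)"
      unfolding pdist2_def I_def using pL2_set_integrable[OF f pzero_qp]
      by (intro sq_norm_set_integral_diff_le) (auto simp: pzero_qp set_integrable_def)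
    also have "\<dots> = ennreal (real p powi (- n) * D)"
      by (simp add: D emeasure_haar_cyl pzero_qp ennreal_mult' less_imp_le)
    finally show ?thesis by (simp add: D_def set_lebesgue_integral_def)
  qed
  have step: "I n = of_nat p * I (n + 1)" for n
  proof -
    have "I n = (\<Sum>d<p. LINT x:cyl (n + 1) (digit_at n d)|haar p. f x)"
      unfolding I_def cyl_zero_split using disjoint_digit_cyls pL2_set_integrable[OF f]
      by (intro set_integral_finite_Union) (auto simp: digit_at_qp)
    also have "\<dots> = (\<Sum>d<p. I (n + 1))"
      unfolding I_def by (intro sum.cong const) (auto simp: digit_at_qp pzero_qp)
    finally show ?thesis by simp
  qed
  have pow: "I (m - int i) = of_nat (p ^ i) * I m" for i
  proof (induction i)
    case (Suc i)
    then show ?case using step[of "m - int (Suc i)"] by simp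
  qed simp
  have grow: "real p ^ i * (cmod (I m))\<^sup>2 \<le> real p powi (- m) * D" for i
  proof -
    have "(real p ^ i)\<^sup>2 * (cmod (I m))\<^sup>2 \<le> real p powi (int i + - m) * D"
      using bound[of "m - int i"] pow[of i] by (simp add: norm_mult norm_power power_mult_distrib)
    then have "real p ^ i * (real p ^ i * (cmod (I m))\<^sup>2) \<le> real p ^ i * (real p powi (- m) * D)"
      unfolding powi_add by (simp add: power2_eq_square mult.assoc)
    then show ?thesis using p_gt_1 by (subst (asm) mult_le_cancel_left_pos) auto
  qed
  have "I m = 0"
  proof (rule ccontr)
    assume "I m \<noteq> 0"
    then have pos: "0 < (cmod (I m))\<^sup>2" by simp
    obtain i where "real p powi (- m) * D / (cmod (I m))\<^sup>2 < real p ^ i"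
      using real_arch_pow[of "real p"] p_gt_1 by auto
    then show False using grow[of i] pos by (simp add: divide_less_eq)
  qed
  then show ?thesis using const[OF a pzero_qp] by (simp add: I_def)
qed

section \<open>Functions whose ball integrals all vanish\<close>

lemma sigma_finite_haar: "sigma_finite_measure (haar p)"
proof
  show "\<exists>A. countable A \<and> A \<subseteq> sets (haar p) \<and> \<Union> A = space (haar p) \<and>
      (\<forall>a\<in>A. emeasure (haar p) a \<noteq> \<infinity>)"
    using Union_cyl_zero pzero_qp
    by (intro exI[of _ "range (\<lambda>i. cyl (- int i) pzero)"]) (auto simp: emeasure_haar_cyl)
qed

text \<open>Vanishing ball integrals say that the positive and negative parts of h, taken as
  densities, give the same finite mass to every ball. The two measures coincide, sigma-finiteness
  makes the densities equal almost everywhere, and the two parts can be equal only where h =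
  0.\<close>

lemma AE_zero_real:
  fixes h :: "(int \<Rightarrow> nat) \<Rightarrow> real"
  assumes [measurable]: "h \<in> borel_measurable (haar p)"
    and int: "\<And>n a. a \<in> qp p \<Longrightarrow> set_integrable (haar p) (cyl n a) h"
    and zero: "\<And>n a. a \<in> qp p \<Longrightarrow> (LINT x:cyl n a|haar p. h x) = 0"
  shows "AE x in haar p. h x = 0"
proof -
  interpret sigma_finite_measure "haar p" by (rule sigma_finite_haar)
  \<comment> \<open>\<open>ennreal\<close> sends negative reals to 0, so s = 1 and s = -1 give the
    integrals of the positive and of the negative part.\<close>
  let ?N = "\<lambda>s n a. \<integral>\<^sup>+x. ennreal (s * (indicator (cyl n a) x * h x)) \<partial>haar p"
  have fin: "?N s n a < \<infinity>" if "a \<in> qp p" "\<bar>s\<bar> = 1" for s n a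
  proof -
    have "integrable (haar p) (\<lambda>x. indicator (cyl n a) x * h x)"
      using int[OF that(1), of n] by (simp add: set_integrable_def)
    then have "(\<integral>\<^sup>+x. ennreal (norm (indicator (cyl n a) x * h x)) \<partial>haar p) < \<infinity>"
      unfolding integrable_iff_bounded by simp
    moreover have "?N s n a \<le> (\<integral>\<^sup>+x. ennreal (norm (indicator (cyl n a) x * h x)) \<partial>haar p)"
      using that(2) by (intro nn_integral_mono ennreal_leI) (auto simp: abs_if split: if_splits)
    ultimately show ?thesis by (simp add: le_less_trans)
  qed
  have eq: "?N 1 n a = ?N (-1) n a" if a: "a \<in> qp p" for n a
  proof -
    have "integrable (haar p) (\<lambda>x. indicator (cyl n a) x * h x)"
      using int[OF a, of n] by (simp add: set_integrable_def)
    from real_lebesgue_integral_def[OF this] zero[OF a, of n]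
    have "enn2real (?N 1 n a) = enn2real (?N (-1) n a)"
      by (simp add: set_lebesgue_integral_def)
    then have "ennreal (enn2real (?N 1 n a)) = ennreal (enn2real (?N (-1) n a))" by simp
    then show ?thesis using fin[OF a, of 1 n] fin[OF a, of "-1" n]
      by (subst (asm) (1 2) ennreal_enn2real) auto
  qed
  have dens: "emeasure (density (haar p) (\<lambda>x. ennreal (s * h x))) (cyl n a) = ?N s n a"
    if "a \<in> qp p" for s n a
    using that by (subst emeasure_density) (auto intro!: nn_integral_cong simp: indicator_def)
  have "density (haar p) (\<lambda>x. ennreal (1 * h x)) = density (haar p) (\<lambda>x. ennreal (-1 * h x))"
  proof (rule qp_measure_eqI)
    fix n a assume "a \<in> qp p"
    then show "emeasure (density (haar p) (\<lambda>x. ennreal (1 * h x))) (cyl n a)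
        = emeasure (density (haar p) (\<lambda>x. ennreal (-1 * h x))) (cyl n a)"
      unfolding dens[OF \<open>a \<in> qp p\<close>] by (rule eq)
  next
    fix n show "emeasure (density (haar p) (\<lambda>x. ennreal (1 * h x))) (cyl n pzero) \<noteq> \<infinity>"
      unfolding dens[OF pzero_qp] using fin[OF pzero_qp, of 1 n] by simp
  qed (use qp_measure_haar in \<open>simp_all add: qp_measure_def\<close>)
  then have "AE x in haar p. ennreal (1 * h x) = ennreal (-1 * h x)"
    by (intro density_unique) auto
  then show ?thesis
  proof eventually_elim
    case (elim x)
    then show ?case
      by (cases "0 \<le> h x") (auto simp: ennreal_neg ennreal_eq_0_iff)
  qed
qed

lemma AE_zero:
  assumes f: "pL2 p f"
    and zero: "\<And>n a. a \<in> qp p \<Longrightarrow> (LINT x:cyl n a|haar p. f x) = 0"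
  shows "AE x in haar p. f x = 0"
proof -
  have m [measurable]: "f \<in> borel_measurable (haar p)" using f by (simp add: pL2_def)
  have i: "integrable (haar p) (\<lambda>x. indicator (cyl n a) x *\<^sub>R f x)" if "a \<in> qp p" for n a
    using pL2_set_integrable[OF f that] by (simp add: set_integrable_def)
  have "AE x in haar p. Re (f x) = 0"
  proof (rule AE_zero_real)
    fix n a assume a: "a \<in> qp p"
    show "set_integrable (haar p) (cyl n a) (\<lambda>x. Re (f x))"
      using integrable_Re[OF i[OF a, of n]] by (simp add: set_integrable_def)
    show "(LINT x:cyl n a|haar p. Re (f x)) = 0"
      using integral_Re[OF i[OF a, of n]] zero[OF a, of n] by (simp add: set_lebesgue_integral_def)
  qed simp
  moreover have "AE x in haar p. Im (f x) = 0"
  proof (rule AE_zero_real)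
    fix n a assume a: "a \<in> qp p"
    show "set_integrable (haar p) (cyl n a) (\<lambda>x. Im (f x))"
      using integrable_Im[OF i[OF a, of n]] by (simp add: set_integrable_def)
    show "(LINT x:cyl n a|haar p. Im (f x)) = 0"
      using integral_Im[OF i[OF a, of n]] zero[OF a, of n] by (simp add: set_lebesgue_integral_def)
  qed simp
  ultimately show ?thesis by eventually_elim (simp add: complex_eq_iff)
qed

subsection \<open>Fourier transform\<close>

lemma mem_cyl_iff:
  assumes "x \<in> qp p" "a \<in> qp p"
  shows "x \<in> cyl n a \<longleftrightarrow> ptrunc p x (n - 1) = ptrunc p a (n - 1)"
proof
  assume "ptrunc p x (n - 1) = ptrunc p a (n - 1)"
  then show "x \<in> cyl n a" using ptrunc_agreeD[OF assms] assms by (simp add: cyl_def)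
qed (auto simp: cyl_def intro: ptrunc_agree)

lemma cis_cong_int: "pcong p 0 r s \<Longrightarrow> cis (2 * pi * r) = cis (2 * pi * s)"
proof -
  assume "pcong p 0 r s"
  then obtain z :: int where "r = s + of_int z" by (auto simp: pcong_def algebra_simps)
  then have "cis (2 * pi * r) = cis (2 * pi * s) * cis (2 * pi * of_int z)"
    by (simp only: cis_mult distrib_left)
  then show ?thesis by simp
qed

text \<open>\<xi> is a multiple of p^(-m) and x of p^(-n), so digits of \<xi> from n on and digits
  of x from m on change the product only by p-adic integers. The character becomes an ordinary
  exponential in finitely many digits.\<close>

lemma pchar_pmul:
  assumes \<xi>: "\<xi> \<in> cyl (- m) pzero" and x: "x \<in> cyl (- n) pzero"
  shows "pchar p (pmul p \<xi> x) = cis (2 * pi * (ptrunc p \<xi> (n - 1) * ptrunc p x (m - 1)))"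
proof -
  have "pfrac p y = ptrunc p y (-1)" for y
    unfolding pfrac_def ptrunc_def by (rule sum.cong) auto
  then have "pchar p y = cis (2 * pi * ptrunc p y (-1))" for y
    by (simp add: pchar_def cis_conv_exp mult_ac)
  moreover have "pcong p 0 (ptrunc p (pmul p \<xi> x) (-1)) (ptrunc p \<xi> (n - 1) * ptrunc p x (m - 1))"
    using ptrunc_pmul[of \<xi> x "- m" "- n" "-1"] \<xi> x by (simp add: cyl_def pzero_def)
  ultimately show ?thesis
    using cis_cong_int by metis
qed

text \<open>The points \<open>k / p ^ m\<close> with \<open>k < p ^ (m + n)\<close> represent the cosets of \<open>B\<^sub>-\<^sub>n(0)\<close> in \<open>B\<^sub>m(0)\<close>.\<close>
lemma lattice_integral:
  fixes h :: "real \<Rightarrow> complex"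
  assumes mn: "- m \<le> n"
  shows "set_integrable (haar p) (cyl (- m) pzero) (\<lambda>\<xi>. h (ptrunc p \<xi> (n - 1)))"
    and "(LINT \<xi>:cyl (- m) pzero|haar p. h (ptrunc p \<xi> (n - 1)))
      = (\<Sum>k<p ^ nat (m + n). (real p powi (- n)) *\<^sub>R h (real k * real p powi (- m)))"
proof -
  define K where "K = p ^ nat (m + n)"
  have "real p powi n = real p powi (m + n) * real p powi (- m)" by (simp flip: powi_add)
  then have K: "real p powi n = real K * real p powi (- m)"
    using mn by (simp add: K_def power_int_def)
  define rep where "rep k = (\<lambda>i. pdig p (real k * real p powi (- m)) i)" for k :: nat
  have lat: "pcong p (- m) (real k * real p powi (- m)) 0" for k :: nat
    unfolding pcong_def by (intro exI[of _ "int k"]) simp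
  \<comment> \<open>A constant sequence is coherent, so \<open>rep k\<close> is the digit expansion
    of the rational number k * p^(-m).\<close>
  note coh = coherent_digits[of "\<lambda>_. real k * real p powi (- m)" for k :: nat, OF pcong_refl lat,
      folded rep_def]
  have rep: "rep k \<in> qp p" for k by (rule coh)
  have trep: "ptrunc p (rep k) (n - 1) = real k * real p powi (- m)" if "k < K" for k
  proof (rule pcong_eq[where n = n])
    show "pcong p n (ptrunc p (rep k) (n - 1)) (real k * real p powi (- m))"
      using coh(2)[of "n - 1" k] by simp
    show "real k * real p powi (- m) < real p powi n" using that by (simp add: K)
  qed (use ptrunc_bounds[OF rep, of k "n - 1"] in \<open>auto simp: less_imp_le\<close>)
  have cyl_rep: "\<xi> \<in> cyl n (rep k) \<longleftrightarrow>
      \<xi> \<in> cyl (- m) pzero \<and> ptrunc p \<xi> (n - 1) = real k * real p powi (- m)"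
    if k: "k < K" and \<xi>: "\<xi> \<in> qp p" for k \<xi>
  proof -
    have "\<xi> \<in> cyl n (rep k) \<longleftrightarrow> ptrunc p \<xi> (n - 1) = real k * real p powi (- m)"
      using mem_cyl_iff[OF \<xi> rep] trep[OF k] by simp
    moreover have "rep k i = 0" if "i < - m" for i
    proof -
      have "rep k i = pdig p 0 i" unfolding rep_def
        using that by (intro pdig_cong pcong_le[OF _ lat]) simp
      then show ?thesis by (simp add: pdig_def)
    qed
    then have "\<xi> \<in> cyl n (rep k) \<Longrightarrow> \<xi> \<in> cyl (- m) pzero"
      using mn by (simp add: cyl_def pzero_def)
    ultimately show ?thesis by blast
  qed
  \<comment> \<open>On the ball the truncation is z * p^(-m) with 0 <= z < K, so exactly the coset k
    = z contributes and the integrand is a finite step function.\<close>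
  have expand: "indicator (cyl (- m) pzero) \<xi> *\<^sub>R h (ptrunc p \<xi> (n - 1))
      = (\<Sum>k<K. indicator (cyl n (rep k)) \<xi> *\<^sub>R h (real k * real p powi (- m)))"
    if \<xi>: "\<xi> \<in> qp p" for \<xi>
  proof (cases "\<xi> \<in> cyl (- m) pzero")
    case True
    then have "pcong p (- m) (ptrunc p \<xi> (n - 1)) 0"
      using ptrunc_integral[OF \<xi>, of "- m"] by (simp add: cyl_def pzero_def)
    then obtain z :: int where z: "ptrunc p \<xi> (n - 1) = of_int z * real p powi (- m)"
      unfolding pcong_def by auto
    have "0 \<le> real_of_int z * real p powi (- m)"
      "real_of_int z * real p powi (- m) < real K * real p powi (- m)"
      using ptrunc_bounds[OF \<xi>, of "n - 1"] z K by simp_all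
    then have "0 \<le> real_of_int z" "real_of_int z < real K"
      by (simp_all only: zero_le_mult_iff mult_less_cancel_right_pos[OF powi_pos])
        (use powi_pos[of "- m"] in linarith)
    then have z0: "0 \<le> z" "nat z < K" by linarith+
    have "indicator (cyl n (rep k)) \<xi> *\<^sub>R h (real k * real p powi (- m))
        = (if k = nat z then h (ptrunc p \<xi> (n - 1)) else 0)" if "k < K" for k
      using cyl_rep[OF that \<xi>] True z0 z by (auto simp: indicator_def)
    then have "(\<Sum>k<K. indicator (cyl n (rep k)) \<xi> *\<^sub>R h (real k * real p powi (- m)))
        = (\<Sum>k<K. if k = nat z then h (ptrunc p \<xi> (n - 1)) else 0)" by (intro sum.cong) auto
    then show ?thesis using True z0 by simp
  next
    case False
    then show ?thesis using cyl_rep[OF _ \<xi>] by (simp add: indicator_def)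
  qed
  have int: "integrable (haar p) (\<lambda>\<xi>. indicator (cyl n (rep k)) \<xi> *\<^sub>R h (real k * real p powi (- m)))"
    for k
    using rep emeasure_haar_cyl_finite[OF rep]
    by (intro integrable_scaleR_left integrable_real_indicator) auto
  have "integrable (haar p) (\<lambda>\<xi>. \<Sum>k<K. indicator (cyl n (rep k)) \<xi> *\<^sub>R h (real k * real p powi (- m)))"
    by (intro Bochner_Integration.integrable_sum int)
  then show "set_integrable (haar p) (cyl (- m) pzero) (\<lambda>\<xi>. h (ptrunc p \<xi> (n - 1)))"
    unfolding set_integrable_def
    by (rule Bochner_Integration.integrable_cong[THEN iffD1, rotated -1]) (auto simp: expand)
  have meas: "measure (haar p) (cyl n (rep k)) = real p powi (- n)" for k
    by (simp add: measure_def emeasure_haar_cyl rep)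
  have "(LINT \<xi>:cyl (- m) pzero|haar p. h (ptrunc p \<xi> (n - 1)))
      = (LINT \<xi>|haar p. (\<Sum>k<K. indicator (cyl n (rep k)) \<xi> *\<^sub>R h (real k * real p powi (- m))))"
    unfolding set_lebesgue_integral_def
    by (rule Bochner_Integration.integral_cong) (auto simp: expand)
  also have "\<dots> = (\<Sum>k<K. LINT \<xi>|haar p. indicator (cyl n (rep k)) \<xi> *\<^sub>R h (real k * real p powi (- m)))"
    by (rule Bochner_Integration.integral_sum) (rule int)
  also have "\<dots> = (\<Sum>k<K. (real p powi (- n)) *\<^sub>R h (real k * real p powi (- m)))"
  proof (rule sum.cong)
    fix k
    have "cyl n (rep k) \<inter> space (haar p) = cyl n (rep k)" using cyl_subset by auto
    moreover have "integrable (haar p) (indicator (cyl n (rep k)) :: _ \<Rightarrow> real)"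
      using rep emeasure_haar_cyl_finite[OF rep] by (intro integrable_real_indicator) auto
    ultimately show "(LINT \<xi>|haar p. indicator (cyl n (rep k)) \<xi> *\<^sub>R h (real k * real p powi (- m)))
        = (real p powi (- n)) *\<^sub>R h (real k * real p powi (- m))"
      by (simp add: meas)
  qed simp
  finally show "(LINT \<xi>:cyl (- m) pzero|haar p. h (ptrunc p \<xi> (n - 1)))
      = (\<Sum>k<p ^ nat (m + n). (real p powi (- n)) *\<^sub>R h (real k * real p powi (- m)))"
    by (simp add: K_def)
qed

text \<open>Orthogonality of characters: with K = p^(m+n), the truncations differ by l * p^(-n),
  which makes the phases k * l / K, and K divides l only if x and a lie in the same ball of radius
  p^(-m).\<close>

lemma lattice_char_sum:
  assumes mn: "- m \<le> n" and x: "x \<in> cyl (- n) pzero" and a: "a \<in> cyl (- n) pzero"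
  shows "(\<Sum>k<p ^ nat (m + n). cis (2 * pi * (real k * real p powi (- m)
      * (ptrunc p x (m - 1) - ptrunc p a (m - 1)))))
    = (if x \<in> cyl m a then of_nat (p ^ nat (m + n)) else 0)"
proof -
  define K where "K = p ^ nat (m + n)"
  have K0: "0 < K" using p_gt_1 by (simp add: K_def)
  have "real p powi (- m) * real p powi (- n) = inverse (real p powi (m + n))"
    by (simp add: add.commute flip: powi_add power_int_minus)
  then have K: "real p powi (- m) * real p powi (- n) = 1 / real K"
    using mn by (simp add: K_def power_int_def divide_inverse)
  have xq: "x \<in> qp p" "a \<in> qp p" using x a by (auto simp: cyl_def)
  have "pcong p (- n) (ptrunc p x (m - 1) - ptrunc p a (m - 1)) 0"
    using pcong_diff[OF ptrunc_integral[OF xq(1), of "- n" "m - 1"]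
        ptrunc_integral[OF xq(2), of "- n" "m - 1"]] x a by (simp add: cyl_def pzero_def)
  then obtain l :: int where l: "ptrunc p x (m - 1) - ptrunc p a (m - 1) = of_int l * real p powi (- n)"
    unfolding pcong_def by auto
  have phase: "real k * real p powi (- m) * (ptrunc p x (m - 1) - ptrunc p a (m - 1))
      = real k * (of_int l / real K)" for k :: nat
    unfolding l using K by (simp add: field_simps)
  have mem: "x \<in> cyl m a \<longleftrightarrow> ptrunc p x (m - 1) = ptrunc p a (m - 1)"
    by (rule mem_cyl_iff[OF xq])
  show ?thesis
  proof (cases "x \<in> cyl m a")
    case True
    then show ?thesis using mem by simp
  next
    case False
    have "\<not> int K dvd l"
    proof
      assume "int K dvd l"
      then obtain q where "l = int K * q" by blast
      moreover have "real K * real p powi (- n) = real p powi m"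
        using K K0 by (simp add: power_int_minus field_simps)
      ultimately have "ptrunc p x (m - 1) - ptrunc p a (m - 1) = of_int q * real p powi m"
        unfolding l by (simp add: mult_ac)
      then have "pcong p m (ptrunc p x (m - 1)) (ptrunc p a (m - 1))" by (auto simp: pcong_def)
      then show False using agree_iff_pcong[OF xq] False xq by (simp add: cyl_def)
    qed
    then show ?thesis unfolding phase K_def[symmetric] using sum_cis_eq_0[OF K0] False by simp
  qed
qed

text \<open>Restriction to the ball of radius p^n. It makes an L2 function integrable, so the
  cut-offs can serve as the approximating sequence in \<open>is_fourier_L2\<close>.\<close>

abbreviation cut :: "((int \<Rightarrow> nat) \<Rightarrow> complex) \<Rightarrow> int \<Rightarrow> (int \<Rightarrow> nat) \<Rightarrow> complex" where
  "cut f n \<equiv> \<lambda>x. indicator (cyl (- n) pzero) x *\<^sub>R f x"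

lemma integrable_cut: "pL2 p f \<Longrightarrow> integrable (haar p) (cut f n)"
  using pL2_set_integrable[OF _ pzero_qp] by (simp add: set_integrable_def)

text \<open>On the ball of radius p^m the integrand g depends only on the truncation of \<xi> at n -
  1, so its integral is a sum over p^(m+n) cosets of measure p^(-n). Linearity moves the sum under
  the integral over x, and \<open>lattice_char_sum\<close> leaves p^(m+n) times the indicator of
  \<open>cyl m a\<close>, which lies inside the cut-off ball because m + n >= 0.\<close>

lemma fourier_cut_cyl_integral:
  assumes f: "pL2 p f" and a: "a \<in> cyl (- n) pzero" and mn: "- m \<le> n" "- n \<le> m"
  defines "g \<equiv> (\<lambda>\<xi>. cnj (pchar p (pmul p \<xi> a)) * pfourier p (cut f n) \<xi>)"
  shows "set_integrable (haar p) (cyl (- m) pzero) g"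
    and "(LINT \<xi>:cyl (- m) pzero|haar p. g \<xi>) = of_real (real p powi m) * (LINT x:cyl m a|haar p. f x)"
proof -
  let ?T = "\<lambda>x. ptrunc p x (m - 1)"
  define h where "h t = (LINT x|haar p. cis (2 * pi * (t * (?T x - ?T a))) * cut f n x)" for t
  have aq: "a \<in> qp p" using a by (auto simp: cyl_def)
  have int: "integrable (haar p) (\<lambda>x. cis (2 * pi * (t * (?T x - c))) * cut f n x)" for t c
  proof (rule Bochner_Integration.integrable_bound[OF integrable_cut[OF f, of n]])
    show "(\<lambda>x. cis (2 * pi * (t * (?T x - c))) * cut f n x) \<in> borel_measurable (haar p)"
      using measurable_ptrunc[of "\<lambda>s. cis (2 * pi * (t * (s - c)))" "m - 1"] integrable_cut[OF f, of n]
      by (intro borel_measurable_times) auto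
  qed (simp add: norm_mult)
  have g: "g \<xi> = h (ptrunc p \<xi> (n - 1))" if \<xi>: "\<xi> \<in> cyl (- m) pzero" for \<xi>
  proof -
    define t where "t = ptrunc p \<xi> (n - 1)"
    have "g \<xi> = (LINT x|haar p. cnj (pchar p (pmul p \<xi> a)) * (pchar p (pmul p \<xi> x) * cut f n x))"
      unfolding g_def pfourier_def by (simp only: integral_mult_right_zero)
    also have "\<dots> = h t"
      unfolding h_def
    proof (rule Bochner_Integration.integral_cong)
      fix x
      show "cnj (pchar p (pmul p \<xi> a)) * (pchar p (pmul p \<xi> x) * cut f n x)
          = cis (2 * pi * (t * (?T x - ?T a))) * cut f n x"
      proof (cases "x \<in> cyl (- n) pzero")
        case True
        show ?thesis
          unfolding pchar_pmul[OF \<xi> True] pchar_pmul[OF \<xi> a] cis_cnj t_def mult.assoc[symmetric] cis_mult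
          by (simp add: algebra_simps)
      qed simp
    qed simp
    finally show ?thesis by (simp add: t_def)
  qed
  have cong: "indicator (cyl (- m) pzero) \<xi> *\<^sub>R h (ptrunc p \<xi> (n - 1))
      = indicator (cyl (- m) pzero) \<xi> *\<^sub>R g \<xi>" for \<xi>
    using g[of \<xi>] by (cases "\<xi> \<in> cyl (- m) pzero") simp_all
  show "set_integrable (haar p) (cyl (- m) pzero) g"
    using lattice_integral(1)[OF mn(1), of h] unfolding set_integrable_def cong .
  have "(LINT \<xi>:cyl (- m) pzero|haar p. g \<xi>)
      = (\<Sum>k<p ^ nat (m + n). (real p powi (- n)) *\<^sub>R h (real k * real p powi (- m)))"
    using lattice_integral(2)[OF mn(1), of h] unfolding set_lebesgue_integral_def cong .
  also have "\<dots> = (real p powi (- n)) *\<^sub>R (\<Sum>k<p ^ nat (m + n). h (real k * real p powi (- m)))"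
    by (simp add: scaleR_sum_right)
  also have "(\<Sum>k<p ^ nat (m + n). h (real k * real p powi (- m)))
      = (LINT x|haar p. (\<Sum>k<p ^ nat (m + n).
          cis (2 * pi * (real k * real p powi (- m) * (?T x - ?T a))) * cut f n x))"
    unfolding h_def by (rule Bochner_Integration.integral_sum[symmetric]) (rule int)
  also have "\<dots> = (LINT x|haar p. of_nat (p ^ nat (m + n)) * (indicator (cyl m a) x *\<^sub>R f x))"
  proof (rule Bochner_Integration.integral_cong)
    fix x assume "x \<in> space (haar p)"
    have sub: "cyl m a \<subseteq> cyl (- n) pzero" using cyl_mono[OF mn(2), of a] cyl_eq[OF a] by simp
    show "(\<Sum>k<p ^ nat (m + n). cis (2 * pi * (real k * real p powi (- m) * (?T x - ?T a))) * cut f n x)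
        = of_nat (p ^ nat (m + n)) * (indicator (cyl m a) x *\<^sub>R f x)"
    proof (cases "x \<in> cyl (- n) pzero")
      case True
      show ?thesis unfolding sum_distrib_right[symmetric] lattice_char_sum[OF mn(1) True a]
        using True by (simp add: indicator_def)
    next
      case False
      then show ?thesis using sub by (auto simp: indicator_def)
    qed
  qed simp
  also have "(real p powi (- n)) *\<^sub>R \<dots>
      = of_real (real p powi (- n) * real (p ^ nat (m + n))) * (LINT x:cyl m a|haar p. f x)"
    unfolding set_lebesgue_integral_def integral_mult_right_zero by (simp add: scaleR_conv_of_real)
  also have "real p powi (- n) * real (p ^ nat (m + n)) = real p powi m"
  proof -
    have "real p powi m = real p powi (- n) * real p powi (m + n)" by (simp flip: powi_add)
    then show ?thesis using mn by (simp add: power_int_def)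
  qed
  finally show "(LINT \<xi>:cyl (- m) pzero|haar p. g \<xi>)
      = of_real (real p powi m) * (LINT x:cyl m a|haar p. f x)" .
qed

section \<open>From cut-offs to the L2 transform\<close>

lemma pL2_cut: "pL2 p f \<Longrightarrow> pL2 p (cut f n)"
  unfolding pL2_def
proof (elim conjE, intro conjI)
  assume f [measurable]: "f \<in> borel_measurable (haar p)" and int: "integrable (haar p) (\<lambda>x. (cmod (f x))\<^sup>2)"
  note [measurable] = cyl_sets[OF pzero_qp]
  show "cut f n \<in> borel_measurable (haar p)" by measurable
  show "integrable (haar p) (\<lambda>x. (cmod (cut f n x))\<^sup>2)"
    by (rule Bochner_Integration.integrable_bound[OF int]) (auto simp: indicator_def)
qed

lemma pdist2_cut_tendsto:
  assumes f: "pL2 p f"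
  shows "(\<lambda>i. pdist2 p (cut f (int i)) f) \<longlonglongrightarrow> 0"
proof -
  have [measurable]: "f \<in> borel_measurable (haar p)" using f by (simp add: pL2_def)
  note [measurable] = cyl_sets[OF pzero_qp]
  have "(\<lambda>i. \<integral>\<^sup>+x. ennreal ((cmod (cut f (int i) x - f x))\<^sup>2) \<partial>haar p) \<longlonglongrightarrow> (\<integral>\<^sup>+x. 0 \<partial>haar p)"
  proof (rule nn_integral_dominated_convergence)
    show "(\<integral>\<^sup>+x. ennreal ((cmod (f x))\<^sup>2) \<partial>haar p) < \<infinity>"
      using f by (subst nn_integral_eq_integral) (auto simp: pL2_def)
    show "AE x in haar p. ennreal ((cmod (cut f (int i) x - f x))\<^sup>2) \<le> ennreal ((cmod (f x))\<^sup>2)" for i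
      by (auto simp: indicator_def)
    show "AE x in haar p. (\<lambda>i. ennreal ((cmod (cut f (int i) x - f x))\<^sup>2)) \<longlonglongrightarrow> 0"
    proof (rule AE_I2)
      fix x assume "x \<in> space (haar p)"
      then obtain i where i: "x \<in> cyl (- int i) pzero" using Union_cyl_zero by auto
      have "\<forall>\<^sub>F j in sequentially. ennreal ((cmod (cut f (int j) x - f x))\<^sup>2) = 0"
        using eventually_ge_at_top[of i]
      proof eventually_elim
        case (elim j)
        then have "x \<in> cyl (- int j) pzero" using cyl_mono[of "- int j" "- int i"] i by auto
        then show ?case by simp
      qed
      then show "(\<lambda>i. ennreal ((cmod (cut f (int i) x - f x))\<^sup>2)) \<longlonglongrightarrow> 0"
        by (rule tendsto_eventually)
    qed
  qed measurable
  then show ?thesis by (simp add: pdist2_def)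
qed

text \<open>The point is measurability of the character in \<xi>: on the ball it is a function of a
  single truncation of \<xi>.\<close>

lemma set_integrable_char_mult:
  assumes f: "pL2 p f" and a: "a \<in> qp p"
  shows "set_integrable (haar p) (cyl (- m) pzero) (\<lambda>\<xi>. cnj (pchar p (pmul p \<xi> a)) * f \<xi>)"
proof -
  obtain i where i: "a \<in> cyl (- int i) pzero" using a Union_cyl_zero by auto
  define e where "e t = cis (- (2 * pi * (t * ptrunc p a (m - 1))))" for t
  define d where "d \<xi> = e (ptrunc p \<xi> (int i - 1)) * cut f m \<xi>" for \<xi>
  have "integrable (haar p) d"
  proof (rule Bochner_Integration.integrable_bound)
    show "integrable (haar p) (cut f m)" by (rule integrable_cut[OF f])
    show "d \<in> borel_measurable (haar p)"
      unfolding d_def using integrable_cut[OF f, of m]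
      by (intro borel_measurable_times measurable_ptrunc) auto
  qed (simp add: d_def e_def norm_mult)
  moreover have "d = (\<lambda>\<xi>. indicator (cyl (- m) pzero) \<xi> *\<^sub>R (cnj (pchar p (pmul p \<xi> a)) * f \<xi>))"
  proof
    fix \<xi>
    show "d \<xi> = indicator (cyl (- m) pzero) \<xi> *\<^sub>R (cnj (pchar p (pmul p \<xi> a)) * f \<xi>)"
      using pchar_pmul[OF _ i, of \<xi> m]
      by (cases "\<xi> \<in> cyl (- m) pzero") (simp_all add: d_def e_def cis_cnj)
  qed
  ultimately show ?thesis by (simp add: set_integrable_def)
qed

text \<open>For large i the identity for the cut-off has a right-hand side independent of i.
  Characters have modulus 1, so by Cauchy-Schwarz the left-hand side follows the convergence of
  \<open>F i\<close> to \<psi>.\<close>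

lemma fourier_cyl_integral:
  assumes \<phi>: "pL2 p \<phi>" and \<psi>: "is_fourier_L2 p \<phi> \<psi>" and a: "a \<in> qp p"
  shows "(LINT \<xi>:cyl (- m) pzero|haar p. cnj (pchar p (pmul p \<xi> a)) * \<psi> \<xi>)
    = of_real (real p powi m) * (LINT x:cyl m a|haar p. \<phi> x)" (is "?L = ?R")
proof -
  define F where "F i = pfourier p (cut \<phi> (int i))" for i
  let ?c = "\<lambda>\<xi>. cnj (pchar p (pmul p \<xi> a))"
  have \<psi>2: "pL2 p \<psi>" using \<psi> by (simp add: is_fourier_L2_def)
  have F: "(\<lambda>i. pdist2 p (F i) \<psi>) \<longlonglongrightarrow> 0"
    using \<psi>[unfolded is_fourier_L2_def pL1_def, THEN conjunct2, THEN spec, of "\<lambda>i. cut \<phi> (int i)"]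
      pL2_cut[OF \<phi>] integrable_cut[OF \<phi>] pdist2_cut_tendsto[OF \<phi>]
    by (simp add: F_def)
  obtain i0 where i0: "a \<in> cyl (- int i0) pzero" using a Union_cyl_zero by auto
  have norm_c: "cmod (pchar p y) = 1" for y
    by (simp add: pchar_def flip: of_real_mult)
  note int_psi = set_integrable_char_mult[OF \<psi>2 a, of m]
  have "\<forall>\<^sub>F i in sequentially. ennreal ((cmod (?R - ?L))\<^sup>2)
      \<le> ennreal (real p powi m) * pdist2 p (F i) \<psi>"
    \<comment> \<open>From i0 on the cut-off ball contains a, and i >= |m| gives m + i >= 0.\<close>
    using eventually_ge_at_top[of "max i0 (nat \<bar>m\<bar>)"]
  proof eventually_elim
    case (elim i)
    then have ai: "a \<in> cyl (- int i) pzero" using cyl_mono[of "- int i" "- int i0"] i0 by auto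
    have mi: "- m \<le> int i" "- int i \<le> m" using elim by linarith+
    note G = fourier_cut_cyl_integral[OF \<phi> ai mi, folded F_def]
    have "ennreal ((cmod (?R - ?L))\<^sup>2)
        \<le> emeasure (haar p) (cyl (- m) pzero) * pdist2 p (\<lambda>\<xi>. ?c \<xi> * F i \<xi>) (\<lambda>\<xi>. ?c \<xi> * \<psi> \<xi>)"
      unfolding pdist2_def G(2)[symmetric]
      by (rule sq_norm_set_integral_diff_le[OF _ G(1) int_psi]) (simp add: pzero_qp)
    also have "pdist2 p (\<lambda>\<xi>. ?c \<xi> * F i \<xi>) (\<lambda>\<xi>. ?c \<xi> * \<psi> \<xi>) = pdist2 p (F i) \<psi>"
      unfolding pdist2_def by (simp add: norm_mult norm_c flip: right_diff_distrib)
    finally show ?case by (simp add: emeasure_haar_cyl pzero_qp)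
  qed
  moreover have "(\<lambda>i. ennreal (real p powi m) * pdist2 p (F i) \<psi>) \<longlonglongrightarrow> ennreal (real p powi m) * 0"
    by (intro ennreal_tendsto_cmult F) simp
  ultimately have "ennreal ((cmod (?R - ?L))\<^sup>2) \<le> ennreal (real p powi m) * 0"
    by (intro tendsto_lowerbound[where F = sequentially]) auto
  then have "(cmod (?R - ?L))\<^sup>2 \<le> 0" by (simp only: mult_zero_right le_zero_eq ennreal_eq_0_iff)
  then show ?thesis by simp
qed

text \<open>For \<xi> in the supporting ball of radius p^\<gamma>, the character at \<xi> a sees
  only the digits of a below \<gamma>. The frequency integrals for a and a' therefore coincide, and
  the duality turns this into equality of the ball integrals.\<close>

lemma cyl_integral_eq_of_fourier_support:
  assumes \<phi>: "pL2 p \<phi>" and \<psi>: "is_fourier_L2 p \<phi> \<psi>"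
    and supp: "AE \<xi> in haar p. \<xi> \<notin> cyl (- \<gamma>) pzero \<longrightarrow> \<psi> \<xi> = 0"
    and a: "a \<in> qp p" and a': "a' \<in> qp p" and agree: "\<forall>k<\<gamma>. a k = a' k"
  shows "(LINT x:cyl m a|haar p. \<phi> x) = (LINT x:cyl m a'|haar p. \<phi> x)"
proof -
  have \<psi>2: "pL2 p \<psi>" using \<psi> by (simp add: is_fourier_L2_def)
  have same: "pchar p (pmul p \<xi> a) = pchar p (pmul p \<xi> a')" if \<xi>: "\<xi> \<in> cyl (- \<gamma>) pzero" for \<xi>
  proof -
    obtain N where N: "\<And>k. k < N \<Longrightarrow> a k = 0" "\<And>k. k < N \<Longrightarrow> a' k = 0"
      using qp_common_bound[OF a a'] by blast
    \<comment> \<open>The double negation matches the form \<open>cyl (- n) pzero\<close> in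
      \<open>pchar_pmul\<close>, instantiated at n = -N.\<close>
    have "a \<in> cyl (- (- N)) pzero" "a' \<in> cyl (- (- N)) pzero"
      using N a a' by (auto simp: cyl_def pzero_def)
    then show ?thesis using pchar_pmul[OF \<xi>, of _ "- N"] ptrunc_agree[of \<gamma> a a'] agree by simp
  qed
  have "(LINT \<xi>:cyl (- m) pzero|haar p. cnj (pchar p (pmul p \<xi> a)) * \<psi> \<xi>)
      = (LINT \<xi>:cyl (- m) pzero|haar p. cnj (pchar p (pmul p \<xi> a')) * \<psi> \<xi>)"
    unfolding set_lebesgue_integral_def
  proof (rule integral_cong_AE)
    show "AE \<xi> in haar p. indicator (cyl (- m) pzero) \<xi> *\<^sub>R (cnj (pchar p (pmul p \<xi> a)) * \<psi> \<xi>)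
        = indicator (cyl (- m) pzero) \<xi> *\<^sub>R (cnj (pchar p (pmul p \<xi> a')) * \<psi> \<xi>)"
      using supp
    proof eventually_elim
      case (elim \<xi>)
      then show ?case using same[of \<xi>] by (cases "\<xi> \<in> cyl (- \<gamma>) pzero") auto
    qed
  qed (use set_integrable_char_mult[OF \<psi>2, of _ m] a a' in \<open>auto simp: set_integrable_def\<close>)
  then have "of_real (real p powi m) * (LINT x:cyl m a|haar p. \<phi> x)
      = of_real (real p powi m) * (LINT x:cyl m a'|haar p. \<phi> x)"
    unfolding fourier_cyl_integral[OF \<phi> \<psi> a] fourier_cyl_integral[OF \<phi> \<psi> a'] .
  then show ?thesis by simp
qed

end

theorem theorem1:
  fixes p :: nat and \<phi> :: "(int \<Rightarrow> nat) \<Rightarrow> complex"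
  assumes "prime p"
    and "pL2 p \<phi>"
    and "\<exists>\<psi> \<gamma>. is_fourier_L2 p \<phi> \<psi> \<and> (AE \<xi> in haar p. \<xi> \<notin> pball p \<gamma> pzero \<longrightarrow> \<psi> \<xi> = 0)"
  shows "\<forall>f. pL2 p f \<and> (\<forall>j::int. pV p \<phi> j f) \<longrightarrow> (AE x in haar p. f x = 0)"
proof (intro allI impI, elim conjE)
  interpret padic_base p using assms(1) by unfold_locales (rule prime_gt_1_nat)
  fix f assume f: "pL2 p f" and V: "\<forall>j. pV p \<phi> j f"
  obtain \<psi> \<gamma> where \<psi>: "is_fourier_L2 p \<phi> \<psi>"
    and supp: "AE \<xi> in haar p. \<xi> \<notin> cyl (- \<gamma>) pzero \<longrightarrow> \<psi> \<xi> = 0"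
    using assms(3) pball_eq_cyl[OF pzero_qp] by auto
  have "(LINT x:cyl m a|haar p. f x) = (LINT x:cyl m a'|haar p. f x)"
    if "a \<in> qp p" "a' \<in> qp p" for m a a'
    using cyl_integral_eq_of_fourier_support[OF assms(2) \<psi> supp] V[rule_format] that
    by (rule pV_cyl_integral_eq[OF assms(2) _ f])
  then have "(LINT x:cyl m a|haar p. f x) = 0" if "a \<in> qp p" for m a
    by (rule cyl_integrals_const_zero[OF f _ that])
  then show "AE x in haar p. f x = 0" by (rule AE_zero[OF f])
qed

end
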